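(* Let $\lambda\ge 1$. Suppose that $\mathcal{A}$ is an operator ideal and $X$ is a real Banach space satisfying that $T^{**}\in\mathcal{A}(\mathfrak{F}(X)^{**},\mathfrak{F}(X))$ whenever $T\in\mathcal{A}(\mathfrak{F}(X),\mathfrak{F}(X))$. Then $X$ has the $\mathcal{A}$-$\lambda$-BAP if $\mathfrak{F}(X)$ has the $\mathcal{A}$-$\lambda$-BAP.
   Context: All Banach spaces are real. $\mathrm{Lip}_0(X)$ is the Banach space of Lipschitz functions $f:X\to\mathbb{R}$ with $f(0)=0$, with norm $\|f\|_{\mathrm{Lip}}=\sup_{x\neq y}|f(x)-f(y)|/\|x-y\|$. For $x\in X$ let $\delta_x\in \mathrm{Lip}_0(X)^*$, $\delta_x(f)=f(x)$. The Lipschitz-free space is $\mathfrak{F}(X)=\overline{\mathrm{span}}\{\delta_x: x\in X\}\subseteq \mathrm{Lip}_0(X)^*$. Operator ideals are (linear) operator ideals in the usual sense. For an operator ideal $\mathcal{A}$ and $\lambda\ge1$, $\mathcal{A}^\lambda(Z,Z)=\{T\in\mathcal{A}(Z,Z):\|T\|\le\lambda\}$; a Banach space $Z$ has the $\mathcal{A}$-$\lambda$-BAP if $\mathrm{Id}_Z\in\overline{\mathcal{A}^\lambda(Z,Z)}^{\tau_c}$, where $\tau_c$ is the compact-open topology (uniform convergence on compact subsets of $Z$). For $T\in\mathcal{L}(Z,Z)$, writing $T^{**}\in\mathcal{A}(Z^{**},Z)$ means that $T^{**}(Z^{**})\subseteq Z$ (with $Z$ canonically embedded in $Z^{**}$)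 and that $T^{**}$, regarded as an operator from $Z^{**}$ into $Z$, belongs to $\mathcal{A}$. *)

theory Defs
  imports "HOL-Analysis.Analysis"
begin

section \<open>The Banach space of Lipschitz functions vanishing at the origin\<close>

typedef (overloaded) ('a::real_normed_vector) lip0 =
  "{f :: 'a \<Rightarrow> real. f 0 = 0 \<and> (\<exists>L. L-lipschitz_on UNIV f)}"
  morphisms lip0_apply Abs_lip0
  by (rule exI[of _ "\<lambda>_. 0"]) (auto intro!: exI[of _ 0] simp: lipschitz_on_def)

setup_lifting type_definition_lip0

(* The pairs x = y contribute 0 / 0 = 0, so that the supremum is over a nonempty set even for
   the trivial space. *)
definition lip_norm :: "('a::real_normed_vector \<Rightarrow> real) \<Rightarrow> real" where
  "lip_norm f = (SUP (x, y). \<bar>f x - f y\<bar> / norm (x - y))"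

lemma lip_quot_le:
  assumes "L-lipschitz_on UNIV f"
  shows "(case p of (x, y) \<Rightarrow> \<bar>f x - f y\<bar> / norm (x - y)) \<le> (L::real)"
proof (cases p)
  case (Pair x y)
  show ?thesis
  proof (cases "x = y")
    case True
    then show ?thesis using lipschitz_on_nonneg[OF assms] Pair by simp
  next
    case False
    then show ?thesis using lipschitz_onD[OF assms, of x y] Pair
      by (simp add: dist_norm divide_simps)
  qed
qed

lemma lip_norm_le:
  assumes "L-lipschitz_on UNIV f" shows "lip_norm f \<le> L"
  unfolding lip_norm_def by (rule cSUP_least) (use lip_quot_le[OF assms] in auto)

lemma lip_norm_bound:
  fixes f :: "'a::real_normed_vector \<Rightarrow> real"
  assumes "\<exists>L. L-lipschitz_on UNIV f"
  shows "\<bar>f x - f y\<bar> \<le> lip_norm f * norm (x - y)"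
proof -
  obtain L where L: "L-lipschitz_on UNIV f" using assms by blast
  have "bdd_above (range (\<lambda>(x, y). \<bar>f x - f y\<bar> / norm (x - y)))"
    by (rule bdd_aboveI[of _ L]) (use lip_quot_le[OF L] in auto)
  from cSUP_upper[OF _ this, of "(x, y)"]
  have "\<bar>f x - f y\<bar> / norm (x - y) \<le> lip_norm f"
    by (simp add: lip_norm_def)
  then show ?thesis by (cases "x = y") (auto simp: divide_simps)
qed

lemma lip_norm_nonneg:
  assumes "\<exists>L. L-lipschitz_on UNIV f"
  shows "0 \<le> lip_norm f"
proof -
  obtain L where L: "L-lipschitz_on UNIV f" using assms by blast
  have "bdd_above (range (\<lambda>(x, y). \<bar>f x - f y\<bar> / norm (x - y)))"
    by (rule bdd_aboveI[of _ L]) (use lip_quot_le[OF L] in auto)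
  from cSUP_upper[OF _ this, of "(0, 0)"] show ?thesis
    by (simp add: lip_norm_def)
qed

lemma lip_norm_lipschitz:
  assumes "\<exists>L. L-lipschitz_on UNIV f"
  shows "(lip_norm f)-lipschitz_on UNIV f"
  using lip_norm_bound[OF assms] lip_norm_nonneg[OF assms]
  by (auto simp: lipschitz_on_def dist_norm)

instantiation lip0 :: (real_normed_vector) real_normed_vector
begin

lift_definition zero_lip0 :: "'a lip0" is "\<lambda>_. 0"
  by (auto intro!: exI[of _ 0] simp: lipschitz_on_def)
lift_definition plus_lip0 :: "'a lip0 \<Rightarrow> 'a lip0 \<Rightarrow> 'a lip0" is "\<lambda>f g x. f x + g x"
  by (auto intro: lipschitz_on_add)
lift_definition uminus_lip0 :: "'a lip0 \<Rightarrow> 'a lip0" is "\<lambda>f x. - f x"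
  by auto
lift_definition minus_lip0 :: "'a lip0 \<Rightarrow> 'a lip0 \<Rightarrow> 'a lip0" is "\<lambda>f g x. f x - g x"
  by (auto intro: lipschitz_on_diff)
lift_definition scaleR_lip0 :: "real \<Rightarrow> 'a lip0 \<Rightarrow> 'a lip0" is "\<lambda>c f x. c * f x"
  by (auto dest: lipschitz_on_cmult_real)
lift_definition norm_lip0 :: "'a lip0 \<Rightarrow> real" is lip_norm .

definition dist_lip0 :: "'a lip0 \<Rightarrow> 'a lip0 \<Rightarrow> real" where
  "dist_lip0 f g = norm (f - g)"
definition sgn_lip0 :: "'a lip0 \<Rightarrow> 'a lip0" where
  "sgn_lip0 f = inverse (norm f) *\<^sub>R f"
definition uniformity_lip0 :: "('a lip0 \<times> 'a lip0) filter" where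
  "uniformity_lip0 = (INF e\<in>{0<..}. principal {(x, y). dist x y < e})"
definition open_lip0 :: "'a lip0 set \<Rightarrow> bool" where
  "open_lip0 U = (\<forall>x\<in>U. \<forall>\<^sub>F (x', y) in uniformity. x' = x \<longrightarrow> y \<in> U)"

instance
proof
  fix f g :: "'a lip0" and a :: real
  show "(norm f = 0) = (f = 0)"
  proof transfer
    fix f :: "'a \<Rightarrow> real" assume f: "f 0 = 0 \<and> (\<exists>L. L-lipschitz_on UNIV f)"
    show "(lip_norm f = 0) = (f = (\<lambda>_. 0))"
    proof
      assume "lip_norm f = 0"
      then show "f = (\<lambda>_. 0)" using lip_norm_bound[of f _ 0] f by fastforce
    qed (simp add: lip_norm_def case_prod_unfold)
  qed
  show "norm (f + g) \<le> norm f + norm g"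
    by transfer (intro lip_norm_le lipschitz_on_add lip_norm_lipschitz; blast)
  show "norm (a *\<^sub>R f) = \<bar>a\<bar> * norm f"
  proof transfer
    fix a and f :: "'a \<Rightarrow> real" assume f: "f 0 = 0 \<and> (\<exists>L. L-lipschitz_on UNIV f)"
    have le: "lip_norm (\<lambda>x. c * g x) \<le> \<bar>c\<bar> * lip_norm g"
      if "\<exists>L. L-lipschitz_on UNIV g" for c and g :: "'a \<Rightarrow> real"
      by (intro lip_norm_le lipschitz_on_cmult_real lip_norm_lipschitz that)
    show "lip_norm (\<lambda>x. a * f x) = \<bar>a\<bar> * lip_norm f"
    proof (cases "a = 0")
      case True
      then show ?thesis by (simp add: lip_norm_def case_prod_unfold)
    next
      case False
      have af: "\<exists>L. L-lipschitz_on UNIV (\<lambda>x. a * f x)"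
        using f lipschitz_on_cmult_real by blast
      have "lip_norm f \<le> \<bar>inverse a\<bar> * lip_norm (\<lambda>x. a * f x)"
        using le[OF af, of "inverse a"] False by (simp add: mult.assoc[symmetric])
      then have "\<bar>a\<bar> * lip_norm f \<le> lip_norm (\<lambda>x. a * f x)"
        using False by (simp add: abs_inverse field_simps)
      moreover have "lip_norm (\<lambda>x. a * f x) \<le> \<bar>a\<bar> * lip_norm f"
        using le f by blast
      ultimately show ?thesis by linarith
    qed
  qed
qed (simp_all only: dist_lip0_def sgn_lip0_def uniformity_lip0_def open_lip0_def,
  (transfer; simp add: algebra_simps; fail)+)

end


section \<open>The Lipschitz-free space\<close>

lift_definition lip_delta :: "'a::real_normed_vector \<Rightarrow> 'a lip0 \<Rightarrow>\<^sub>L real" is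
  "\<lambda>x f. lip0_apply f x"
proof (rule bounded_linear_intro)
  fix x :: 'a and f g :: "'a lip0" and r :: real
  show "lip0_apply (f + g) x = lip0_apply f x + lip0_apply g x" by transfer simp
  show "lip0_apply (r *\<^sub>R f) x = r *\<^sub>R lip0_apply f x" by transfer simp
  show "norm (lip0_apply f x) \<le> norm f * norm x"
    by transfer (use lip_norm_bound[of _ _ 0] in fastforce)
qed

lemma subspace_closure_span:
  fixes B :: "'b::real_normed_vector set"
  shows "subspace (closure (span B))"
proof (rule subspaceI)
  show "0 \<in> closure (span B)"
    using closure_subset span_zero by blast
next
  fix x y assume "x \<in> closure (span B)" "y \<in> closure (span B)"
  then obtain f g where "\<And>n. f n \<in> span B" "f \<longlonglongrightarrow> x" "\<And>n. g n \<in> span B" "g \<longlonglongrightarrow> y"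
    unfolding closure_sequential by metis
  then show "x + y \<in> closure (span B)"
    unfolding closure_sequential
    by (intro exI[of _ "\<lambda>n. f n + g n"]) (auto intro: span_add tendsto_add)
next
  fix x and c :: real assume "x \<in> closure (span B)"
  then obtain f where "\<And>n. f n \<in> span B" "f \<longlonglongrightarrow> x"
    unfolding closure_sequential by metis
  then show "c *\<^sub>R x \<in> closure (span B)"
    unfolding closure_sequential
    by (intro exI[of _ "\<lambda>n. c *\<^sub>R f n"]) (auto intro: span_scale tendsto_scaleR)
qed

typedef (overloaded) ('a::real_normed_vector) lipfree =
  "closure (span (range (lip_delta :: 'a \<Rightarrow> 'a lip0 \<Rightarrow>\<^sub>L real)))"
  morphisms lipfree_functional Abs_lipfree
  using subspace_0[OF subspace_closure_span] by blast

setup_lifting type_definition_lipfree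

instantiation lipfree :: (real_normed_vector) real_normed_vector
begin

lift_definition zero_lipfree :: "'a lipfree" is 0
  by (rule subspace_0[OF subspace_closure_span])
lift_definition plus_lipfree :: "'a lipfree \<Rightarrow> 'a lipfree \<Rightarrow> 'a lipfree" is "(+)"
  by (rule subspace_add[OF subspace_closure_span])
lift_definition uminus_lipfree :: "'a lipfree \<Rightarrow> 'a lipfree" is uminus
  by (rule subspace_neg[OF subspace_closure_span])
lift_definition minus_lipfree :: "'a lipfree \<Rightarrow> 'a lipfree \<Rightarrow> 'a lipfree" is "(-)"
  by (rule subspace_diff[OF subspace_closure_span])
lift_definition scaleR_lipfree :: "real \<Rightarrow> 'a lipfree \<Rightarrow> 'a lipfree" is "(*\<^sub>R)"
  by (rule subspace_scale[OF subspace_closure_span])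
lift_definition norm_lipfree :: "'a lipfree \<Rightarrow> real" is norm .

definition dist_lipfree :: "'a lipfree \<Rightarrow> 'a lipfree \<Rightarrow> real" where
  "dist_lipfree f g = norm (f - g)"
definition sgn_lipfree :: "'a lipfree \<Rightarrow> 'a lipfree" where
  "sgn_lipfree f = inverse (norm f) *\<^sub>R f"
definition uniformity_lipfree :: "('a lipfree \<times> 'a lipfree) filter" where
  "uniformity_lipfree = (INF e\<in>{0<..}. principal {(x, y). dist x y < e})"
definition open_lipfree :: "'a lipfree set \<Rightarrow> bool" where
  "open_lipfree U = (\<forall>x\<in>U. \<forall>\<^sub>F (x', y) in uniformity. x' = x \<longrightarrow> y \<in> U)"

instance
  by standard
    ((simp only: dist_lipfree_def sgn_lipfree_def uniformity_lipfree_def open_lipfree_def; fail) |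
     (transfer; simp add: algebra_simps norm_triangle_ineq; fail))+

end

instance lipfree :: (real_normed_vector) banach
proof
  fix X :: "nat \<Rightarrow> 'a lipfree" assume X: "Cauchy X"
  have dist: "dist (lipfree_functional x) (lipfree_functional y) = dist x y" for x y :: "'a lipfree"
    unfolding dist_norm by transfer simp
  have "Cauchy (\<lambda>n. lipfree_functional (X n))"
    using X by (simp add: Cauchy_def dist)
  then obtain l where l: "(\<lambda>n. lipfree_functional (X n)) \<longlonglongrightarrow> l"
    using Cauchy_convergent_iff convergent_def by blast
  have "l \<in> closure (span (range lip_delta))"
    by (rule closed_sequentially[OF closed_closure _ l]) (rule lipfree_functional)
  then obtain m where m: "l = lipfree_functional m"
    by (metis Abs_lipfree_inverse)
  have "X \<longlonglongrightarrow> m"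
    using l unfolding m tendsto_iff dist .
  then show "convergent X" by (auto simp: convergent_def)
qed


section \<open>Biduals\<close>

type_synonym 'a bidual = "('a \<Rightarrow>\<^sub>L real) \<Rightarrow>\<^sub>L real"

lift_definition bidual_embed :: "'a::real_normed_vector \<Rightarrow> 'a bidual" is
  "\<lambda>x f. blinfun_apply f x"
  by (rule bounded_bilinear.bounded_linear_left[OF bounded_bilinear_blinfun_apply])

lift_definition adjoint_op ::
  "('a::real_normed_vector \<Rightarrow>\<^sub>L 'b::real_normed_vector) \<Rightarrow> ('b \<Rightarrow>\<^sub>L real) \<Rightarrow>\<^sub>L ('a \<Rightarrow>\<^sub>L real)" is
  "\<lambda>T f. f o\<^sub>L T"
  by (rule bounded_bilinear.bounded_linear_left[OF bounded_bilinear_blinfun_compose])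


section \<open>Operator ideals\<close>

(* HOL cannot quantify over all types inside a formula, so an operator ideal is modelled as an
   assignment on all Banach spaces whose carrier is a subset of one universe type 'u. For the
   ideal to speak about a Banach space type 'a, the universe must be large enough: there must be
   an injection from 'a into 'u. *)
record 'u vspace =
  vcarrier :: "'u set"
  vzero :: 'u
  vadd :: "'u \<Rightarrow> 'u \<Rightarrow> 'u"
  vscale :: "real \<Rightarrow> 'u \<Rightarrow> 'u"
  vnorm :: "'u \<Rightarrow> real"

definition vdist :: "'u vspace \<Rightarrow> 'u \<Rightarrow> 'u \<Rightarrow> real" where
  "vdist E x y = vnorm E (vadd E x (vscale E (- 1) y))"

locale banach_space =
  fixes E :: "'u vspace"
  assumes zero_closed: "vzero E \<in> vcarrier E"
    and add_closed: "\<lbrakk>x \<in> vcarrier E; y \<in> vcarrier E\<rbrakk> \<Longrightarrow> vadd E x y \<in> vcarrier E"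
    and scale_closed: "x \<in> vcarrier E \<Longrightarrow> vscale E a x \<in> vcarrier E"
    and add_assoc: "\<lbrakk>x \<in> vcarrier E; y \<in> vcarrier E; z \<in> vcarrier E\<rbrakk> \<Longrightarrow>
      vadd E (vadd E x y) z = vadd E x (vadd E y z)"
    and add_commute: "\<lbrakk>x \<in> vcarrier E; y \<in> vcarrier E\<rbrakk> \<Longrightarrow> vadd E x y = vadd E y x"
    and add_zero: "x \<in> vcarrier E \<Longrightarrow> vadd E x (vzero E) = x"
    and add_inverse: "x \<in> vcarrier E \<Longrightarrow> \<exists>y\<in>vcarrier E. vadd E x y = vzero E"
    and scale_add_right: "\<lbrakk>x \<in> vcarrier E; y \<in> vcarrier E\<rbrakk> \<Longrightarrow>
      vscale E a (vadd E x y) = vadd E (vscale E a x) (vscale E a y)"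
    and scale_add_left: "x \<in> vcarrier E \<Longrightarrow>
      vscale E (a + b) x = vadd E (vscale E a x) (vscale E b x)"
    and scale_scale: "x \<in> vcarrier E \<Longrightarrow> vscale E a (vscale E b x) = vscale E (a * b) x"
    and scale_one: "x \<in> vcarrier E \<Longrightarrow> vscale E 1 x = x"
    and norm_eq_zero: "x \<in> vcarrier E \<Longrightarrow> vnorm E x = 0 \<longleftrightarrow> x = vzero E"
    and norm_scale: "x \<in> vcarrier E \<Longrightarrow> vnorm E (vscale E a x) = \<bar>a\<bar> * vnorm E x"
    and norm_triangle: "\<lbrakk>x \<in> vcarrier E; y \<in> vcarrier E\<rbrakk> \<Longrightarrow>
      vnorm E (vadd E x y) \<le> vnorm E x + vnorm E y"
    and complete: "Metric_space.mcomplete (vcarrier E) (vdist E)"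

(* Operators are extensional functions: they take the value undefined outside the carrier. *)
definition bounded_ops :: "'u vspace \<Rightarrow> 'u vspace \<Rightarrow> ('u \<Rightarrow> 'u) set" where
  "bounded_ops E F = {T \<in> vcarrier E \<rightarrow>\<^sub>E vcarrier F.
     (\<forall>x\<in>vcarrier E. \<forall>y\<in>vcarrier E. T (vadd E x y) = vadd F (T x) (T y)) \<and>
     (\<forall>a. \<forall>x\<in>vcarrier E. T (vscale E a x) = vscale F a (T x)) \<and>
     (\<exists>C. \<forall>x\<in>vcarrier E. vnorm F (T x) \<le> C * vnorm E x)}"

definition linear_subspace :: "'u vspace \<Rightarrow> 'u set \<Rightarrow> bool" where
  "linear_subspace F V \<longleftrightarrow> V \<subseteq> vcarrier F \<and> vzero F \<in> V \<and>
     (\<forall>x\<in>V. \<forall>y\<in>V. vadd F x y \<in> V) \<and> (\<forall>a. \<forall>x\<in>V. vscale F a x \<in> V)"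

definition finite_rank :: "'u vspace \<Rightarrow> 'u vspace \<Rightarrow> ('u \<Rightarrow> 'u) \<Rightarrow> bool" where
  "finite_rank E F T \<longleftrightarrow> (\<exists>B. finite B \<and> B \<subseteq> vcarrier F \<and>
     T ` vcarrier E \<subseteq> \<Inter> {V. linear_subspace F V \<and> B \<subseteq> V})"

locale operator_ideal =
  fixes A :: "'u vspace \<Rightarrow> 'u vspace \<Rightarrow> ('u \<Rightarrow> 'u) set"
  assumes bounded: "\<lbrakk>banach_space E; banach_space F\<rbrakk> \<Longrightarrow> A E F \<subseteq> bounded_ops E F"
    and add: "\<lbrakk>banach_space E; banach_space F; S \<in> A E F; T \<in> A E F\<rbrakk> \<Longrightarrow>
      (\<lambda>x\<in>vcarrier E. vadd F (S x) (T x)) \<in> A E F"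
    and scale: "\<lbrakk>banach_space E; banach_space F; T \<in> A E F\<rbrakk> \<Longrightarrow>
      (\<lambda>x\<in>vcarrier E. vscale F a (T x)) \<in> A E F"
    and finite_rank: "\<lbrakk>banach_space E; banach_space F; T \<in> bounded_ops E F; finite_rank E F T\<rbrakk> \<Longrightarrow>
      T \<in> A E F"
    and ideal: "\<lbrakk>banach_space E\<^sub>0; banach_space E; banach_space F; banach_space F\<^sub>0;
        S \<in> bounded_ops E\<^sub>0 E; T \<in> A E F; R \<in> bounded_ops F F\<^sub>0\<rbrakk> \<Longrightarrow>
      compose (vcarrier E\<^sub>0) R (compose (vcarrier E\<^sub>0) T S) \<in> A E\<^sub>0 F\<^sub>0"

(* The isometric copy of a Banach space type inside the universe along an injection i. *)
definition copy :: "('a::real_normed_vector \<Rightarrow> 'u) \<Rightarrow> 'u vspace" where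
  "copy i = \<lparr>vcarrier = range i, vzero = i 0,
     vadd = (\<lambda>u v. i (inv i u + inv i v)), vscale = (\<lambda>a u. i (a *\<^sub>R inv i u)),
     vnorm = (\<lambda>u. norm (inv i u))\<rparr>"

definition transport ::
  "('a \<Rightarrow> 'u) \<Rightarrow> ('b \<Rightarrow> 'u) \<Rightarrow> ('a::real_normed_vector \<Rightarrow>\<^sub>L 'b::real_normed_vector) \<Rightarrow> 'u \<Rightarrow> 'u" where
  "transport i j T = (\<lambda>u\<in>range i. j (T (inv i u)))"

(* Membership in the ideal of an operator between Banach space types. By ideal_mem_iff below
   it does not depend on the copies chosen. *)
definition ideal_mem ::
  "('u vspace \<Rightarrow> 'u vspace \<Rightarrow> ('u \<Rightarrow> 'u) set) \<Rightarrow> ('a::banach \<Rightarrow>\<^sub>L 'b::banach) \<Rightarrow> bool" where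
  "ideal_mem A T \<longleftrightarrow> (\<exists>(i :: 'a \<Rightarrow> 'u) (j :: 'b \<Rightarrow> 'u).
     inj i \<and> inj j \<and> transport i j T \<in> A (copy i) (copy j))"

lemma copy_simps [simp]:
  "vcarrier (copy i) = range i" "vzero (copy i) = i 0"
  "vadd (copy i) u v = i (inv i u + inv i v)" "vscale (copy i) a u = i (a *\<^sub>R inv i u)"
  "vnorm (copy i) u = norm (inv i u)"
  by (simp_all add: copy_def)

lemma banach_space_copy:
  fixes i :: "'a::banach \<Rightarrow> 'u"
  assumes i: "inj i"
  shows "banach_space (copy i)"
proof -
  have d: "vdist (copy i) (i x) (i y) = dist x y" for x y
    using i by (simp add: vdist_def dist_norm)
  interpret M: Metric_space "range i" "vdist (copy i)"
  proof
    show "0 \<le> vdist (copy i) x y" for x y by (simp add: vdist_def)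
    show "vdist (copy i) x y = vdist (copy i) y x" for x y
      using i by (simp add: vdist_def norm_minus_commute)
  qed (auto simp: d dist_triangle)
  have "M.mcomplete"
    unfolding M.mcomplete_def
  proof (intro allI impI)
    fix \<sigma> assume \<sigma>: "M.MCauchy \<sigma>"
    define s where "s n = inv i (\<sigma> n)" for n
    have \<sigma>s: "\<sigma> n = i (s n)" for n
      using \<sigma> unfolding M.MCauchy_def s_def by (metis f_inv_into_f range_subsetD)
    have "Cauchy s"
      using \<sigma> unfolding M.MCauchy_def Cauchy_def \<sigma>s d by meson
    then obtain l where "s \<longlonglongrightarrow> l"
      using Cauchy_convergent_iff convergent_def by blast
    then have "limitin M.mtopology \<sigma> (i l) sequentially"
      unfolding M.limitin_metric \<sigma>s d tendsto_iff by simp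
    then show "\<exists>x. limitin M.mtopology \<sigma> x sequentially" by blast
  qed
  moreover have "\<exists>y\<in>range i. i (inv i (i x) + inv i y) = i 0" for x
    using i by (intro bexI[of _ "i (- x)"]) auto
  ultimately show ?thesis
    by unfold_locales (use i in \<open>auto simp: algebra_simps norm_triangle_ineq\<close>)
qed

lemma transport_bounded_ops:
  fixes i :: "'a::banach \<Rightarrow> 'u" and j :: "'b::banach \<Rightarrow> 'u"
  assumes i: "inj i" and j: "inj j"
  shows "transport i j T \<in> bounded_ops (copy i) (copy j)"
  unfolding bounded_ops_def transport_def using i j
  by (auto simp: blinfun.add_right blinfun.scaleR_right mult.commute
      intro!: exI[of _ "norm T"] norm_blinfun)

lemma (in operator_ideal) ideal_mem_iff:
  fixes i :: "'a::banach \<Rightarrow> 'u" and j :: "'b::banach \<Rightarrow> 'u"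
  assumes i: "inj i" and j: "inj j"
  shows "ideal_mem A T \<longleftrightarrow> transport i j T \<in> A (copy i) (copy j)"
proof
  assume "ideal_mem A T"
  then obtain i' :: "'a \<Rightarrow> 'u" and j' :: "'b \<Rightarrow> 'u" where
    i': "inj i'" and j': "inj j'" and T: "transport i' j' T \<in> A (copy i') (copy j')"
    unfolding ideal_mem_def by blast
  have "compose (range i) (transport j' j id_blinfun)
      (compose (range i) (transport i' j' T) (transport i i' id_blinfun)) = transport i j T"
    using i i' j' by (auto simp: compose_def transport_def fun_eq_iff restrict_def)
  then show "transport i j T \<in> A (copy i) (copy j)"
    using ideal[OF banach_space_copy[OF i] banach_space_copy[OF i'] banach_space_copy[OF j']
        banach_space_copy[OF j] transport_bounded_ops[OF i i'] T transport_bounded_ops[OF j' j],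
        of id_blinfun id_blinfun]
    by simp
qed (use i j in \<open>auto simp: ideal_mem_def\<close>)

(* T** maps the bidual of 'a into the canonical image of 'b and belongs to the ideal as an
   operator S from the bidual of 'a to 'b. *)
definition bidual_ideal_mem ::
  "('u vspace \<Rightarrow> 'u vspace \<Rightarrow> ('u \<Rightarrow> 'u) set) \<Rightarrow> ('a::banach \<Rightarrow>\<^sub>L 'b::banach) \<Rightarrow> bool" where
  "bidual_ideal_mem A T \<longleftrightarrow>
     range (adjoint_op (adjoint_op T)) \<subseteq> range bidual_embed \<and>
     (\<exists>S :: 'a bidual \<Rightarrow>\<^sub>L 'b.
        (\<forall>\<phi>. bidual_embed (blinfun_apply S \<phi>) = blinfun_apply (adjoint_op (adjoint_op T)) \<phi>) \<and> ideal_mem A S)"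


section \<open>The bounded approximation property of an ideal\<close>

definition compact_open_topology ::
  "('a::real_normed_vector \<Rightarrow>\<^sub>L 'b::real_normed_vector) topology" where
  "compact_open_topology =
     topology_generated_by {{T. blinfun_apply T ` K \<subseteq> U} | K U. compact K \<and> open U}"

definition has_ideal_BAP ::
  "('u vspace \<Rightarrow> 'u vspace \<Rightarrow> ('u \<Rightarrow> 'u) set) \<Rightarrow> real \<Rightarrow> 'a::banach itself \<Rightarrow> bool" where
  "has_ideal_BAP A r _ \<longleftrightarrow>
     id_blinfun \<in> compact_open_topology closure_of {T :: 'a \<Rightarrow>\<^sub>L 'a. ideal_mem A T \<and> norm T \<le> r}"

lemma closure_of_compact_open_topology:
  fixes S :: "'a::real_normed_vector \<Rightarrow>\<^sub>L 'b::real_normed_vector"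
  shows "S \<in> compact_open_topology closure_of C \<longleftrightarrow>
     (\<forall>K e. compact K \<and> 0 < e \<longrightarrow> (\<exists>T\<in>C. \<forall>x\<in>K. norm (blinfun_apply T x - blinfun_apply S x) < e))"
    (is "_ \<longleftrightarrow> ?R")
proof -
  define B :: "('a \<Rightarrow>\<^sub>L 'b) set set"
    where "B = {{T. blinfun_apply T ` K \<subseteq> U} | K U. compact K \<and> open U}"
  have top: "compact_open_topology = topology_generated_by B"
    by (simp add: compact_open_topology_def B_def)
  have "UNIV \<in> B" unfolding B_def by (rule CollectI, rule exI[of _ "{}"]) auto
  then have UN: "\<Union>B = UNIV" by blast
  have basis: "\<exists>K e. compact K \<and> 0 < e \<and>
      {T. \<forall>x\<in>K. norm (blinfun_apply T x - blinfun_apply S x) < e} \<subseteq> W"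
    if "generate_topology_on B W" "S \<in> W" for W
    using that
  proof induction
    case (Int W1 W2)
    then obtain K1 e1 K2 e2 where *: "compact K1" "0 < e1" "compact K2" "0 < e2"
      "{T. \<forall>x\<in>K1. norm (blinfun_apply T x - blinfun_apply S x) < e1} \<subseteq> W1"
      "{T. \<forall>x\<in>K2. norm (blinfun_apply T x - blinfun_apply S x) < e2} \<subseteq> W2"
      using Int.IH Int.prems by blast
    then have "compact (K1 \<union> K2)" "0 < min e1 e2"
      "{T. \<forall>x\<in>K1 \<union> K2. norm (blinfun_apply T x - blinfun_apply S x) < min e1 e2} \<subseteq> W1 \<inter> W2"
      by auto
    then show ?case by blast
  next
    case (UN \<W>)
    then obtain W where "W \<in> \<W>" "S \<in> W" by blast
    with UN.IH obtain K e where "compact K" "0 < e"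
      "{T. \<forall>x\<in>K. norm (blinfun_apply T x - blinfun_apply S x) < e} \<subseteq> W"
      by blast
    with \<open>W \<in> \<W>\<close> have "{T. \<forall>x\<in>K. norm (blinfun_apply T x - blinfun_apply S x) < e} \<subseteq> \<Union>\<W>"
      by blast
    with \<open>compact K\<close> \<open>0 < e\<close> show ?case by blast
  next
    case (Basis W)
    then obtain K U where W: "W = {T. blinfun_apply T ` K \<subseteq> U}" and K: "compact K" and "open U"
      by (auto simp: B_def)
    have "compact (blinfun_apply S ` K)"
      by (intro compact_continuous_image K continuous_intros)
    then obtain e where e: "0 < e" "(\<Union>x\<in>blinfun_apply S ` K. ball x e) \<subseteq> U"
      using compact_subset_open_imp_ball_epsilon_subset[of "blinfun_apply S ` K" U]
        \<open>open U\<close> Basis.prems W by auto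
    have "T \<in> W" if T: "\<forall>x\<in>K. norm (blinfun_apply T x - blinfun_apply S x) < e" for T
    proof -
      have "blinfun_apply T x \<in> U" if "x \<in> K" for x
      proof -
        have "blinfun_apply T x \<in> ball (blinfun_apply S x) e"
          using T that by (simp add: dist_norm norm_minus_commute)
        with e(2) that show ?thesis by blast
      qed
      then show ?thesis by (auto simp: W)
    qed
    with K e(1) show ?case by blast
  qed auto
  show ?thesis
  proof
    assume S: "S \<in> compact_open_topology closure_of C"
    show ?R
    proof (intro allI impI, elim conjE)
      fix K :: "'a set" and e :: real assume K: "compact K" and e: "0 < e"
      define V where "V d = {y. dist (blinfun_apply S d) (blinfun_apply S y) < e / 3}" for d
      have "open (V d)" for d
        unfolding V_def by (intro open_Collect_less continuous_intros)
      moreover have "K \<subseteq> (\<Union>d\<in>K. V d)" using e by (auto simp: V_def)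
      ultimately obtain D where D: "D \<subseteq> K" "finite D" "K \<subseteq> (\<Union>d\<in>D. V d)"
        using compactE_image[OF K, of K V] by metis
      define Kd where
        "Kd d = K \<inter> {y. dist (blinfun_apply S d) (blinfun_apply S y) \<le> e / 3}" for d
      define N where
        "N d = {T :: 'a \<Rightarrow>\<^sub>L 'b. blinfun_apply T ` Kd d \<subseteq> ball (blinfun_apply S d) (e / 2)}" for d
      have cK: "compact (Kd d)" for d
        unfolding Kd_def by (intro compact_Int_closed K closed_Collect_le continuous_intros)
      have "openin compact_open_topology (N d)" for d
        unfolding top by (rule topology_generated_by_Basis) (use cK in \<open>auto simp: B_def N_def\<close>)
      then have "openin compact_open_topology ((\<Inter>d\<in>D. N d) \<inter> topspace compact_open_topology)"
        using D(2) by (intro openin_INT)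
      moreover have "topspace (compact_open_topology :: ('a \<Rightarrow>\<^sub>L 'b) topology) = UNIV"
        by (simp add: top UN)
      moreover have "S \<in> (\<Inter>d\<in>D. N d)" using e by (auto simp: N_def Kd_def)
      ultimately have "S \<in> (\<Inter>d\<in>D. N d) \<and> openin compact_open_topology (\<Inter>d\<in>D. N d)"
        by simp
      then have "\<exists>T. T \<in> C \<and> T \<in> (\<Inter>d\<in>D. N d)"
        using S unfolding in_closure_of by presburger
      then obtain T where T: "T \<in> C" "\<And>d. d \<in> D \<Longrightarrow> T \<in> N d" by blast
      have "norm (blinfun_apply T x - blinfun_apply S x) < e" if "x \<in> K" for x
      proof -
        obtain d where d: "d \<in> D" "x \<in> V d" using D(3) \<open>x \<in> K\<close> by blast
        then have "x \<in> Kd d" using \<open>x \<in> K\<close> by (auto simp: V_def Kd_def)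
        then have "dist (blinfun_apply S d) (blinfun_apply T x) < e / 2"
          using T(2)[OF d(1)] by (auto simp: N_def)
        moreover have "dist (blinfun_apply S d) (blinfun_apply S x) < e / 3"
          using d(2) by (simp add: V_def)
        ultimately have "dist (blinfun_apply T x) (blinfun_apply S x) < e"
          using dist_triangle3[of "blinfun_apply T x" "blinfun_apply S x" "blinfun_apply S d"] e
          by linarith
        then show ?thesis by (simp add: dist_norm)
      qed
      with T(1) show "\<exists>T\<in>C. \<forall>x\<in>K. norm (blinfun_apply T x - blinfun_apply S x) < e" by blast
    qed
  next
    assume R: ?R
    show "S \<in> compact_open_topology closure_of C"
      unfolding in_closure_of
    proof (intro conjI allI impI)
      show "S \<in> topspace compact_open_topology" by (simp add: top UN)
      fix W assume "S \<in> W \<and> openin compact_open_topology W"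
      then have "S \<in> W" "openin compact_open_topology W" by auto
      then have "generate_topology_on B W"
        by (simp add: top openin_topology_generated_by_iff)
      from basis[OF this \<open>S \<in> W\<close>] R show "\<exists>T. T \<in> C \<and> T \<in> W" by blast
    qed
  qed
qed

end

theory Submission
  imports Defs
begin

text \<open>
  The Dirac map from a Banach space \<open>X\<close> to its free space \<open>F\<close> is a Lipschitz right inverse of
  the barycentre map \<open>\<beta>\<close>, a linear contraction of \<open>F\<close> onto \<open>X\<close>. If it were linear, then
  \<open>\<beta> \<circ> T \<circ> dirac\<close> would approximate the identity of \<open>X\<close> whenever \<open>T\<close> approximates the identity
  of \<open>F\<close>. A linear right inverse with values in \<open>F\<close> need not exist, but there are linear
  contractions \<open>U\<close> from \<open>X\<close> to the bidual of \<open>F\<close> that lift the identity, and the hypothesis on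
  the ideal says exactly that an operator \<open>T\<close> in the ideal extends to an operator \<open>S\<close> in the ideal
  from the bidual of \<open>F\<close> to \<open>F\<close>. So \<open>\<beta> \<circ> S \<circ> U\<close> belongs to the ideal and has norm at most that
  of \<open>T\<close>.

  It is close to the identity only if \<open>T\<close> is controlled on the values of \<open>U\<close>, and closeness of
  \<open>T\<close> to the identity on compact subsets of \<open>F\<close> says nothing about the rest of the bidual. The
  lifting is therefore adapted to the compact set: given finitely many points of \<open>X\<close>, theorem
  \<open>ex_linear_lifting\<close> produces a \<open>U\<close> that maps each of them to an element of \<open>F\<close> with this point
  as barycentre. Taking for these points a finite net of the compact set and then choosing \<open>T\<close>
  close to the identity on their finitely many images finishes the proof, as all operators are
  uniformly bounded.

  The lifting is a derivative of a smoothed Dirac map. Smoothing over the parallelepiped spanned by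
  the given points makes the map differentiable in their directions, with derivatives in \<open>F\<close>; in
  the other directions a generalised limit of difference quotients is made linear by averaging over
  all base points with a translation invariant mean on \<open>X\<close> (\<open>ex_invariant_mean\<close>,
  \<open>bounded_linear_mean_increment\<close>). The same averaging, applied to a Busemann function of the norm,
  yields norming functionals, which are needed for the barycentre map and for the embedding into
  the bidual.
\<close>

section \<open>Means on bounded functions\<close>

text \<open>
  Real functions are total in HOL, so a mean is defined on all functions, but it is additive and
  homogeneous on the bounded ones only.
\<close>
locale mean =
  fixes M :: "('i \<Rightarrow> real) \<Rightarrow> real"
  assumes add: "\<lbrakk>bounded (range g); bounded (range h)\<rbrakk> \<Longrightarrow> M (\<lambda>i. g i + h i) = M g + M h"
    and mult: "bounded (range g) \<Longrightarrow> M (\<lambda>i. c * g i) = c * M g"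
    and bound: "(\<And>i. \<bar>g i\<bar> \<le> B) \<Longrightarrow> \<bar>M g\<bar> \<le> B"
    and const: "M (\<lambda>i. c) = c"
begin

lemma diff:
  assumes "bounded (range g)" "bounded (range h)"
  shows "M (\<lambda>i. g i - h i) = M g - M h"
proof -
  have "bounded (range (\<lambda>i. - h i))"
    using assms(2) by (simp add: bounded_iff)
  then show ?thesis
    using add[OF assms(1), of "\<lambda>i. - h i"] mult[OF assms(2), of "- 1"] by simp
qed

end

text \<open>
  The evaluations \<open>h \<mapsto> h i\<close> lie in a product of compact intervals, one for each function,
  so by Tychonoff's theorem they have a cluster point along the filter. Linear identities and
  bounds that hold for all evaluations pass to the cluster point, and where the function already
  converges, the cluster point must agree with the limit. The cluster point replaces an ultrafilter
  finer than the given filter.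
\<close>
theorem ex_generalised_limit:
  fixes F :: "'i filter"
  assumes F: "F \<noteq> bot"
  obtains M where "mean M" "\<And>h l. \<lbrakk>bounded (range h); (h \<longlongrightarrow> l) F\<rbrakk> \<Longrightarrow> M h = l"
proof -
  \<comment> \<open>Evaluation is cut off at unbounded functions so that every coordinate stays in an interval.\<close>
  define ev :: "'i \<Rightarrow> ('i \<Rightarrow> real) \<Rightarrow> real" where "ev i h = (if bounded (range h) then h i else 0)" for i h
  have "\<exists>b. \<forall>i. ev i h \<in> {- b..b}" for h
  proof (cases "bounded (range h)")
    case True
    then obtain b where "\<And>i. \<bar>h i\<bar> \<le> b" by (auto simp: bounded_iff)
    then show ?thesis unfolding ev_def atLeastAtMost_iff by (metis True abs_le_iff minus_le_iff)
  next
    case False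
    then show ?thesis by (auto simp: ev_def intro!: exI[of _ 0])
  qed
  then obtain b where b: "\<And>h i. ev i h \<in> {- b h..b h}" by metis
  define K where "K = (\<Pi>\<^sub>E h\<in>(UNIV :: ('i \<Rightarrow> real) set). {- b h..b h})"
  have "compactin (product_topology (\<lambda>_. euclidean) UNIV) K"
    unfolding K_def by (subst compactin_PiE) simp
  then have "compact K"
    by (simp add: euclidean_product_topology flip: compactin_euclidean_iff)
  moreover have "eventually (\<lambda>w. w \<in> K) (filtermap ev F)"
    using b by (simp add: eventually_filtermap K_def PiE_def)
  ultimately obtain M where M: "inf (nhds M) (filtermap ev F) \<noteq> bot"
    using F unfolding compact_filter by (metis filtermap_bot_iff)
  define G where "G = inf (nhds M) (filtermap ev F)"
  have evG: "eventually P G" if "eventually (\<lambda>i. P (ev i)) F" for P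
    using that filter_leD[of G "filtermap ev F"] by (simp add: G_def eventually_filtermap)
  have lim: "((\<lambda>w. w h) \<longlongrightarrow> M h) G" for h
  proof -
    have "((\<lambda>w. w h) \<longlongrightarrow> M h) (nhds M)"
    proof (rule topological_tendstoI)
      fix U :: "real set" assume "open U" "M h \<in> U"
      then have "open ((\<lambda>w :: ('i \<Rightarrow> real) \<Rightarrow> real. w h) -` U)"
        by (intro open_vimage continuous_on_product_coordinates)
      then show "eventually (\<lambda>w. w h \<in> U) (nhds M)"
        using \<open>M h \<in> U\<close> unfolding eventually_nhds by blast
    qed
    then show ?thesis by (rule tendsto_mono[rotated]) (simp add: G_def)
  qed
  have G: "G \<noteq> bot" using M by (simp add: G_def)
  have limit: "M h = l" if h: "bounded (range h)" and l: "(h \<longlongrightarrow> l) F" for h l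
  proof (rule tendsto_unique[OF G lim])
    have "((\<lambda>i. ev i h) \<longlongrightarrow> l) F" using l h by (simp add: ev_def)
    then have "((\<lambda>w. w h) \<longlongrightarrow> l) (filtermap ev F)" by (simp add: filterlim_filtermap)
    then show "((\<lambda>w. w h) \<longlongrightarrow> l) G" by (rule tendsto_mono[rotated]) (simp add: G_def)
  qed
  have "mean M"
  proof
    show "M (\<lambda>i. g i + h i) = M g + M h" if "bounded (range g)" "bounded (range h)" for g h
    proof (rule tendsto_unique[OF G lim])
      have "eventually (\<lambda>w. w g + w h = w (\<lambda>i. g i + h i)) G"
        by (rule evG) (use that bounded_plus_comp[of g UNIV h] in \<open>simp add: ev_def\<close>)
      then show "((\<lambda>w. w (\<lambda>i. g i + h i)) \<longlongrightarrow> M g + M h) G"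
        by (rule Lim_transform_eventually[OF tendsto_add[OF lim lim]])
    qed
    show "M (\<lambda>i. c * g i) = c * M g" if "bounded (range g)" for c g
    proof (rule tendsto_unique[OF G lim])
      have "eventually (\<lambda>w. c * w g = w (\<lambda>i. c * g i)) G"
        by (rule evG) (use that bounded_scaleR_comp[of g UNIV c] in \<open>simp add: ev_def\<close>)
      then show "((\<lambda>w. w (\<lambda>i. c * g i)) \<longlongrightarrow> c * M g) G"
        by (rule Lim_transform_eventually[OF tendsto_mult_left[OF lim]])
    qed
    show "\<bar>M g\<bar> \<le> B" if "\<And>i. \<bar>g i\<bar> \<le> B" for g B
    proof (rule tendsto_upperbound[OF tendsto_rabs[OF lim] _ G])
      have "bounded (range g)" using that by (auto simp: bounded_iff)
      then show "eventually (\<lambda>w. \<bar>w g\<bar> \<le> B) G"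
        by (intro evG) (simp add: ev_def that)
    qed
    show "M (\<lambda>i. c) = c" for c by (rule limit) auto
  qed
  with limit that show thesis by blast
qed

section \<open>Averages along arithmetic progressions\<close>

text \<open>
  The same averages serve two purposes: with a fixed step and many terms they produce an invariant
  mean, and with small steps that fill a segment they smooth a Lipschitz map.
\<close>
definition avg :: "nat \<Rightarrow> 'a::real_vector \<Rightarrow> ('a \<Rightarrow> 'v::real_vector) \<Rightarrow> 'a \<Rightarrow> 'v" where
  "avg n v F y = (1 / real n) *\<^sub>R (\<Sum>k<n. F (y + real k *\<^sub>R v))"

definition iter_avg :: "nat \<Rightarrow> 'a::real_vector list \<Rightarrow> ('a \<Rightarrow> 'v::real_vector) \<Rightarrow> 'a \<Rightarrow> 'v" where
  "iter_avg n = fold (avg n)"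

lemma iter_avg_Nil [simp]: "iter_avg n [] F = F"
  and iter_avg_Cons [simp]: "iter_avg n (v # vs) F = iter_avg n vs (avg n v F)"
  by (simp_all add: iter_avg_def)

lemma avg_telescope:
  "avg n v F (y + v) - avg n v F y = (1 / real n) *\<^sub>R (F (y + real n *\<^sub>R v) - F y)"
proof -
  have "(\<Sum>k<n. F (y + v + real k *\<^sub>R v)) - (\<Sum>k<n. F (y + real k *\<^sub>R v))
      = (\<Sum>k<n. F (y + real (Suc k) *\<^sub>R v) - F (y + real k *\<^sub>R v))"
    by (simp add: sum_subtractf algebra_simps)
  also have "\<dots> = F (y + real n *\<^sub>R v) - F y"
    using sum_lessThan_telescope[of "\<lambda>k. F (y + real k *\<^sub>R v)" n] by simp
  finally show ?thesis unfolding avg_def by (simp flip: scaleR_diff_right)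
qed

text \<open>
  This lets any direction of an iterated average be made the outermost one.
\<close>
lemma avg_commute: "avg n v (avg m w F) = avg m w (avg n v F)"
  unfolding avg_def scaleR_sum_right[symmetric] scaleR_scaleR
  by (subst sum.swap) (simp add: ac_simps fun_eq_iff)

text \<open>
  The shift \<open>z\<close> makes one lemma cover both uses: comparing two functions (\<open>z = 0\<close>) and preserving
  a Lipschitz bound (\<open>F = G\<close>).
\<close>
lemma avg_close:
  fixes F G :: "'a::real_vector \<Rightarrow> 'v::real_normed_vector"
  assumes "0 < n" "\<And>y. norm (F y - G (y + z)) \<le> B"
  shows "norm (avg n v F y - avg n v G (y + z)) \<le> B"
proof -
  have "avg n v F y - avg n v G (y + z)
      = (1 / real n) *\<^sub>R (\<Sum>k<n. F (y + real k *\<^sub>R v) - G (y + real k *\<^sub>R v + z))"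
    unfolding avg_def scaleR_diff_right[symmetric] sum_subtractf by (simp add: algebra_simps)
  also have "norm \<dots> \<le> (1 / real n) * (\<Sum>k<n. B)"
    unfolding norm_scaleR by (intro mult_mono sum_norm_le assms) (use assms(1) in auto)
  also have "\<dots> = B" using assms(1) by simp
  finally show ?thesis .
qed

lemma iter_avg_close:
  fixes F G :: "'a::real_vector \<Rightarrow> 'v::real_normed_vector"
  assumes "0 < n" "\<And>y. norm (F y - G (y + z)) \<le> B"
  shows "norm (iter_avg n vs F y - iter_avg n vs G (y + z)) \<le> B"
  using assms(2)
proof (induction vs arbitrary: F G)
  case (Cons v vs)
  show ?case unfolding iter_avg_Cons
    by (intro Cons.IH avg_close[OF assms(1)] Cons.prems)
qed simp

lemma iter_avg_norm_le:
  fixes F :: "'a::real_vector \<Rightarrow> 'v::real_normed_vector"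
  assumes "0 < n" "\<And>y. norm (F y) \<le> B"
  shows "norm (iter_avg n vs F y) \<le> B"
proof -
  have "avg n v (\<lambda>_. 0) = (\<lambda>_. 0 :: 'v)" for v :: 'a by (simp add: avg_def fun_eq_iff)
  then have "iter_avg n vs (\<lambda>_. 0) = (\<lambda>_. 0 :: 'v)" by (induction vs) auto
  with iter_avg_close[OF assms(1), of F "\<lambda>_. 0" 0 B vs y] assms(2) show ?thesis by simp
qed

text \<open>
  A step in one of the directions of averaging telescopes along that direction and leaves the
  average over the remaining directions.
\<close>
lemma iter_avg_telescope:
  assumes "v \<in> set vs"
  shows "iter_avg n vs F (y + v) - iter_avg n vs F y =
    (1 / real n) *\<^sub>R (iter_avg n (remove1 v vs) F (y + real n *\<^sub>R v) - iter_avg n (remove1 v vs) F y)"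
proof -
  have *: "avg n x \<circ> avg n y = avg n y \<circ> avg n x"
    for x y :: 'a and n by (simp add: fun_eq_iff avg_commute[of n x])
  have "fold (avg n) vs = avg n v \<circ> fold (avg n) (remove1 v vs)"
    unfolding fold_remove1_split[of vs "avg n", OF * assms]
    by (rule fold_commute[symmetric]) (rule *)
  then have "iter_avg n vs F = avg n v (iter_avg n (remove1 v vs) F)"
    by (metis comp_apply iter_avg_def)
  then show ?thesis by (simp only: avg_telescope)
qed

lemma iter_avg_translate: "iter_avg n vs (\<lambda>y. F (y + z)) y = iter_avg n vs F (y + z)"
proof (induction vs arbitrary: F)
  case (Cons v vs)
  have "avg n v (\<lambda>y. F (y + z)) = (\<lambda>y. avg n v F (y + z))"
    by (simp add: avg_def fun_eq_iff algebra_simps)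
  then show ?case using Cons.IH[of "avg n v F"] by simp
qed simp

lemma iter_avg_add: "iter_avg n vs (\<lambda>y. F y + G y) y = iter_avg n vs F y + iter_avg n vs G y"
proof (induction vs arbitrary: F G)
  case (Cons v vs)
  have "avg n v (\<lambda>y. F y + G y) = (\<lambda>y. avg n v F y + avg n v G y)"
    by (simp add: avg_def fun_eq_iff sum.distrib scaleR_add_right)
  then show ?case using Cons.IH by simp
qed simp

lemma iter_avg_linear:
  assumes "linear L"
  shows "iter_avg n vs (\<lambda>y. L (F y)) y = L (iter_avg n vs F y)"
proof (induction vs arbitrary: F)
  case (Cons v vs)
  have "avg n v (\<lambda>y. L (F y)) = (\<lambda>y. L (avg n v F y))"
    by (simp add: avg_def fun_eq_iff linear_sum[OF assms] linear_scale[OF assms])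
  then show ?case using Cons.IH by simp
qed simp

lemma iter_avg_const:
  assumes "0 < n"
  shows "iter_avg n vs (\<lambda>_. c) y = c"
proof (induction vs)
  case (Cons v vs)
  have "avg n v (\<lambda>_. c) = (\<lambda>_. c)"
    using assms by (simp add: avg_def fun_eq_iff sum_constant_scaleR)
  then show ?case using Cons.IH by simp
qed simp

section \<open>A translation invariant mean and the linearisation of Lipschitz functions\<close>

locale invariant_mean = mean M for M :: "('a::real_vector \<Rightarrow> real) \<Rightarrow> real" +
  assumes translate: "bounded (range g) \<Longrightarrow> M (\<lambda>y. g (y + z)) = M g"

text \<open>
  Averaging over a long progression in direction \<open>z\<close> makes the increment by \<open>z\<close> small, because the
  sum telescopes. The mean is a generalised limit of iterated averages at the origin, taken over
  all finite sets of directions and lengths of progressions.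
\<close>
theorem ex_invariant_mean:
  obtains M :: "('a::real_vector \<Rightarrow> real) \<Rightarrow> real" where "invariant_mean M"
proof -
  define F :: "('a set \<times> nat) filter" where "F = finite_sets_at_top \<times>\<^sub>F sequentially"
  have "F \<noteq> bot" by (simp add: F_def prod_filter_eq_bot)
  then obtain L :: "('a set \<times> nat \<Rightarrow> real) \<Rightarrow> real"
    where "mean L" and limit: "\<And>h l. \<lbrakk>bounded (range h); (h \<longlongrightarrow> l) F\<rbrakk> \<Longrightarrow> L h = l"
    by (rule ex_generalised_limit) blast
  interpret L: mean L by fact
  define lst :: "'a set \<Rightarrow> 'a list" where "lst V = (SOME vs. set vs = V)" for V
  have lst: "set (lst V) = V" if "finite V" for V
    unfolding lst_def by (rule someI_ex) (rule finite_list[OF that])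
  define I :: "('a \<Rightarrow> real) \<Rightarrow> 'a \<Rightarrow> 'a set \<times> nat \<Rightarrow> real"
    where "I g y i = iter_avg (Suc (snd i)) (lst (fst i)) g y" for g y i
  have I_le: "\<bar>I g y i\<bar> \<le> B" if "\<And>y. \<bar>g y\<bar> \<le> B" for g y i B
    unfolding I_def real_norm_def[symmetric] by (rule iter_avg_norm_le) (use that in auto)
  have I_bounded: "bounded (range (I g y))" if g: "bounded (range g)" for g y
  proof -
    obtain B where B: "\<And>y. \<bar>g y\<bar> \<le> B" using g by (auto simp: bounded_iff)
    show ?thesis using I_le[of g B, OF B] by (auto simp: bounded_iff intro!: exI[of _ B])
  qed
  define M where "M g = L (I g 0)" for g
  have "invariant_mean M"
  proof
    have "I (\<lambda>y. g y + h y) 0 = (\<lambda>i. I g 0 i + I h 0 i)" for g h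
      by (rule ext) (simp add: I_def iter_avg_add)
    then show "M (\<lambda>y. g y + h y) = M g + M h" if "bounded (range g)" "bounded (range h)" for g h
      using L.add[OF I_bounded I_bounded] that by (simp add: M_def)
    have "I (\<lambda>y. c * g y) 0 = (\<lambda>i. c * I g 0 i)" for c g
      by (rule ext) (simp add: I_def iter_avg_linear[OF linear_times])
    then show "M (\<lambda>y. c * g y) = c * M g" if "bounded (range g)" for c g
      using L.mult[OF I_bounded] that by (simp add: M_def)
    show "\<bar>M g\<bar> \<le> B" if "\<And>i. \<bar>g i\<bar> \<le> B" for g B
      unfolding M_def by (intro L.bound I_le that)
    have "I (\<lambda>_. c) 0 = (\<lambda>_. c)" for c
      by (rule ext) (simp add: I_def iter_avg_const)
    then show "M (\<lambda>_. c) = c" for c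
      by (simp add: M_def L.const)
    show "M (\<lambda>y. g (y + z)) = M g" if g: "bounded (range g)" for g z
    proof -
      obtain B where B: "\<And>y. \<bar>g y\<bar> \<le> B" using g by (auto simp: bounded_iff)
      \<comment> \<open>Telescoping in direction \<open>z\<close> leaves one difference of averages, each bounded by \<open>B\<close>.\<close>
      have est: "\<bar>I g z i - I g 0 i\<bar> \<le> 2 * B / real (Suc (snd i))" if "z \<in> fst i" "finite (fst i)" for i
      proof -
        let ?H = "iter_avg (Suc (snd i)) (remove1 z (lst (fst i))) g"
        have H: "\<bar>?H y\<bar> \<le> B" for y
          unfolding real_norm_def[symmetric] by (rule iter_avg_norm_le) (use B in auto)
        have "I g z i - I g 0 i = (1 / real (Suc (snd i))) * (?H (real (Suc (snd i)) *\<^sub>R z) - ?H 0)"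
          using iter_avg_telescope[of z "lst (fst i)" "Suc (snd i)" g 0] that
          by (simp add: I_def lst)
        moreover have "\<bar>?H (real (Suc (snd i)) *\<^sub>R z) - ?H 0\<bar> \<le> 2 * B"
          using H[of "real (Suc (snd i)) *\<^sub>R z"] H[of 0] by linarith
        ultimately show ?thesis by (simp add: abs_mult divide_right_mono)
      qed
      have "((\<lambda>i. I g z i - I g 0 i) \<longlongrightarrow> 0) F"
      proof (rule Lim_null_comparison)
        have "eventually (\<lambda>V. z \<in> V \<and> finite V) finite_sets_at_top"
          unfolding eventually_finite_subsets_at_top by (rule exI[of _ "{z}"]) auto
        then have "eventually (\<lambda>i. z \<in> fst i \<and> finite (fst i)) F"
          unfolding F_def by (rule eventually_compose_filterlim[OF _ filterlim_fst])
        then show "eventually (\<lambda>i. norm (I g z i - I g 0 i) \<le> 2 * B * inverse (real (Suc (snd i)))) F"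
          by eventually_elim (use est in \<open>simp add: divide_inverse\<close>)
        show "((\<lambda>i. 2 * B * inverse (real (Suc (snd i)))) \<longlongrightarrow> 0) F"
          unfolding F_def
          by (rule filterlim_compose[OF _ filterlim_snd])
             (rule tendsto_mult_right_zero[OF LIMSEQ_inverse_real_of_nat])
      qed
      then have "L (\<lambda>i. I g z i - I g 0 i) = 0"
        using bounded_minus_comp[OF I_bounded[OF g, of z] I_bounded[OF g, of 0]] by (intro limit)
      then have "L (I g z) = L (I g 0)"
        using L.diff[OF I_bounded[OF g, of z] I_bounded[OF g, of 0]] by simp
      moreover have "I (\<lambda>y. g (y + z)) 0 = I g z"
        by (simp add: I_def fun_eq_iff iter_avg_translate)
      ultimately show ?thesis by (simp add: M_def)
    qed
  qed
  then show thesis by (rule that)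
qed

text \<open>
  An additive map is homogeneous for integers. Rounding the multiple \<open>n * t\<close> to an integer costs a
  bounded amount, which disappears after division by \<open>n\<close>.
\<close>
lemma bounded_linear_if_additive:
  fixes f :: "'a::real_normed_vector \<Rightarrow> 'b::real_normed_vector"
  assumes add: "\<And>x y. f (x + y) = f x + f y" and bound: "\<And>x. norm (f x) \<le> norm x * C"
  shows "bounded_linear f"
proof (rule bounded_linear_intro[of f, OF add _ bound])
  interpret additive f by standard (rule add)
  have nat: "f (real n *\<^sub>R x) = real n *\<^sub>R f x" for n x
    by (induction n) (simp_all add: zero add scaleR_add_left)
  have int: "f (of_int k *\<^sub>R x) = of_int k *\<^sub>R f x" for k x
    by (cases k rule: int_cases2) (simp_all add: nat minus)
  fix t :: real and x
  have "norm (f (t *\<^sub>R x) - t *\<^sub>R f x) \<le> 2 * \<bar>C\<bar> * norm x * inverse (real (Suc n))" for n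
  proof -
    let ?n = "real (Suc n)" and ?k = "of_int \<lfloor>real (Suc n) * t\<rfloor> :: real"
    have k: "\<bar>?n * t - ?k\<bar> \<le> 1" by linarith
    have "?n *\<^sub>R (f (t *\<^sub>R x) - t *\<^sub>R f x) = f ((?n * t - ?k) *\<^sub>R x) - (?n * t - ?k) *\<^sub>R f x"
      using nat[of "Suc n" "t *\<^sub>R x"] int[of "\<lfloor>real (Suc n) * t\<rfloor>" x]
      by (simp add: diff algebra_simps del: of_nat_Suc)
    also have "norm \<dots> \<le> norm ((?n * t - ?k) *\<^sub>R x) * C + \<bar>?n * t - ?k\<bar> * (norm x * C)"
      by (intro order_trans[OF norm_triangle_ineq4] add_mono bound)
         (simp add: mult_left_mono bound)
    also have "\<dots> = \<bar>?n * t - ?k\<bar> * (2 * C * norm x)" by simp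
    also have "\<dots> \<le> \<bar>?n * t - ?k\<bar> * (2 * \<bar>C\<bar> * norm x)"
      by (intro mult_left_mono mult_right_mono) auto
    also have "\<dots> \<le> 1 * (2 * \<bar>C\<bar> * norm x)"
      by (intro mult_right_mono k) auto
    finally have "?n * norm (f (t *\<^sub>R x) - t *\<^sub>R f x) \<le> 2 * \<bar>C\<bar> * norm x"
      by (simp del: of_nat_Suc)
    then show ?thesis by (simp add: field_simps del: of_nat_Suc)
  qed
  then have "norm (f (t *\<^sub>R x) - t *\<^sub>R f x) \<le> 0"
    by (intro LIMSEQ_le_const[OF tendsto_mult_right_zero[OF LIMSEQ_inverse_real_of_nat]]) blast
  then show "f (t *\<^sub>R x) = t *\<^sub>R f x" by simp
qed

text \<open>
  The mean increment of a Lipschitz function is additive, since the increment by \<open>x + z\<close> is the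
  increment by \<open>z\<close> followed by a translate of the increment by \<open>x\<close>. Although a Lipschitz function
  need not be bounded, its increments are.
\<close>
lemma bounded_linear_mean_increment:
  fixes D :: "'a::real_normed_vector \<Rightarrow> real"
  assumes M: "invariant_mean M" and lip: "\<And>x y. \<bar>D x - D y\<bar> \<le> norm (x - y) * C"
  shows "bounded_linear (\<lambda>x. M (\<lambda>y. D (y + x) - D y))" (is "bounded_linear ?P")
    and "\<bar>M (\<lambda>y. D (y + x) - D y)\<bar> \<le> norm x * C"
proof -
  interpret invariant_mean M by fact
  have inc: "\<bar>D (y + x) - D y\<bar> \<le> norm x * C" for x y
    using lip[of "y + x" y] by simp
  then have bdd: "bounded (range (\<lambda>y. D (y + x) - D y))" for x
    by (auto simp: bounded_iff)
  show bound: "\<bar>?P x\<bar> \<le> norm x * C" for x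
    by (rule bound) (rule inc)
  show "bounded_linear ?P"
  proof (rule bounded_linear_if_additive)
    fix x z
    have "?P x + ?P z = M (\<lambda>y. D (y + z + x) - D (y + z)) + ?P z"
      using translate[OF bdd[of x], of z] by simp
    also have "\<dots> = M (\<lambda>y. (D (y + z + x) - D (y + z)) + (D (y + z) - D y))"
      by (rule add[symmetric]) (use inc[of _ x] bdd in \<open>auto simp: bounded_iff\<close>)
    finally show "?P (x + z) = ?P x + ?P z" by (simp add: algebra_simps)
  qed (use bound in simp)
qed

text \<open>
  The Hahn--Banach theorem in the form needed here, obtained from the invariant mean: the Busemann
  function \<open>D y = lim (norm (y + n *\<^sub>R x) - n * norm x)\<close> has Lipschitz constant at most 1 and grows
  by exactly \<open>norm x\<close> along \<open>x\<close> from every base point, so its linearisation norms \<open>x\<close>.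
\<close>
lemma ex_norming_functional:
  fixes x :: "'a::real_normed_vector"
  obtains \<phi> :: "'a \<Rightarrow>\<^sub>L real" where "norm \<phi> \<le> 1" "\<phi> x = norm x"
proof -
  obtain M :: "('a \<Rightarrow> real) \<Rightarrow> real" where M: "invariant_mean M"
    by (rule ex_invariant_mean)
  interpret invariant_mean M by fact
  define d where "d y n = norm (y + real n *\<^sub>R x) - real n * norm x" for y n
  have step: "d y (Suc n) \<le> d y n" for y n
    using norm_triangle_ineq[of "y + real n *\<^sub>R x" x] by (simp add: d_def algebra_simps)
  have lower: "- norm y \<le> d y n" for y n
    using norm_triangle_ineq2[of "real n *\<^sub>R x" "- y"] by (simp add: d_def algebra_simps)
  have "convergent (d y)" for y
    using decseq_convergent[of "d y" "- norm y"] decseq_SucI[of "d y"] step lower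
    unfolding convergent_def by metis
  then obtain D where D: "\<And>y. d y \<longlonglongrightarrow> D y"
    unfolding convergent_def by metis
  have lip: "\<bar>D y - D z\<bar> \<le> norm (y - z) * 1" for y z
  proof (rule tendsto_upperbound[OF tendsto_rabs[OF tendsto_diff[OF D D]]])
    have "\<bar>d y n - d z n\<bar> \<le> norm (y - z) * 1" for n
      using norm_triangle_ineq3[of "y + real n *\<^sub>R x" "z + real n *\<^sub>R x"] by (simp add: d_def)
    then show "eventually (\<lambda>n. \<bar>d y n - d z n\<bar> \<le> norm (y - z) * 1) sequentially" by simp
  qed simp
  have "D (y + x) = D y + norm x" for y
  proof (rule LIMSEQ_unique[OF D])
    have "d (y + x) n = d y (Suc n) + norm x" for n
      by (simp add: d_def algebra_simps)
    then show "d (y + x) \<longlonglongrightarrow> D y + norm x"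
      using tendsto_add[OF LIMSEQ_Suc[OF D[of y]] tendsto_const[of "norm x"]] by presburger
  qed
  then have value_x: "M (\<lambda>y. D (y + x) - D y) = norm x"
    by (simp add: const)
  define \<phi> where "\<phi> = Blinfun (\<lambda>v. M (\<lambda>y. D (y + v) - D y))"
  have \<phi>: "blinfun_apply \<phi> v = M (\<lambda>y. D (y + v) - D y)" for v
    unfolding \<phi>_def
    by (simp add: bounded_linear_Blinfun_apply bounded_linear_mean_increment(1)[OF M lip])
  have "norm \<phi> \<le> 1"
    by (rule norm_blinfun_bound) (use bounded_linear_mean_increment(2)[OF M lip] \<phi> in auto)
  with value_x \<phi> show thesis using that by simp
qed

lemma norm_bidual_embed: "norm (bidual_embed x) = norm x"
proof (rule antisym)
  show "norm (bidual_embed x) \<le> norm x"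
    by (rule norm_blinfun_bound)
       (simp_all add: bidual_embed.rep_eq norm_blinfun mult.commute[of "norm x"] del: real_norm_def)
  obtain \<phi> :: "'a \<Rightarrow>\<^sub>L real" where \<phi>: "norm \<phi> \<le> 1" "\<phi> x = norm x"
    by (rule ex_norming_functional)
  have "norm x \<le> norm (bidual_embed x) * norm \<phi>"
    using norm_blinfun[of "bidual_embed x" \<phi>] \<phi>(2) by (simp add: bidual_embed.rep_eq)
  also have "\<dots> \<le> norm (bidual_embed x) * 1"
    by (intro mult_left_mono \<phi>(1)) simp
  finally show "norm x \<le> norm (bidual_embed x)" by simp
qed

lemma bidual_embed_diff: "bidual_embed (x - y) = bidual_embed x - bidual_embed y"
  by (rule blinfun_eqI) (simp add: bidual_embed.rep_eq blinfun.diff_left blinfun.diff_right)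

lemma inj_bidual_embed: "inj bidual_embed"
  by (rule injI) (metis bidual_embed_diff norm_bidual_embed norm_eq_zero right_minus_eq)

section \<open>The barycentre map\<close>

lift_definition dirac :: "'a::real_normed_vector \<Rightarrow> 'a lipfree" is lip_delta
  by (intro subsetD[OF closure_subset] span_base rangeI)

text \<open>
  Only the Lipschitz bound is recorded; it is the half of the isometry property of the Dirac map
  that holds without producing test functions.
\<close>
lemma norm_dirac_diff_le: "norm (dirac x - dirac y) \<le> norm (x - y)"
proof (transfer, rule norm_blinfun_bound)
  fix x y :: 'a and f :: "'a lip0"
  have "\<exists>L. L-lipschitz_on UNIV (lip0_apply f)" using lip0_apply[of f] by simp
  then have "\<bar>lip0_apply f x - lip0_apply f y\<bar> \<le> norm f * norm (x - y)"
    unfolding norm_lip0.rep_eq by (rule lip_norm_bound)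
  then show "norm (blinfun_apply (lip_delta x - lip_delta y) f) \<le> norm (x - y) * norm f"
    by (simp add: blinfun.diff_left lip_delta.rep_eq mult.commute[of "norm f"])
qed simp

text \<open>
  The barycentre map is the preadjoint of this inclusion of the dual space into the Lipschitz
  functions.
\<close>
definition lip0_of_functional :: "('a::real_normed_vector \<Rightarrow>\<^sub>L real) \<Rightarrow> 'a lip0" where
  "lip0_of_functional \<phi> = Abs_lip0 (blinfun_apply \<phi>)"

lemma functional_lipschitz: "(norm \<phi>)-lipschitz_on UNIV (blinfun_apply \<phi>)"
proof (rule lipschitz_onI)
  show "dist (blinfun_apply \<phi> x) (blinfun_apply \<phi> y) \<le> norm \<phi> * dist x y" for x y
    using norm_blinfun[of \<phi> "x - y"] by (simp add: dist_norm blinfun.diff_right)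
qed simp

lemma lip0_apply_of_functional [simp]: "lip0_apply (lip0_of_functional \<phi>) = blinfun_apply \<phi>"
  unfolding lip0_of_functional_def
  by (rule Abs_lip0_inverse) (use functional_lipschitz[of \<phi>] in \<open>auto simp: blinfun.zero_right\<close>)

lemma norm_lip0_of_functional: "norm (lip0_of_functional \<phi>) \<le> norm \<phi>"
  by (simp add: norm_lip0.rep_eq lip_norm_le functional_lipschitz)

text \<open>
  The barycentre is first a relation on all functionals on Lipschitz functions, because the
  functionals that have a barycentre must be shown to form a closed subspace before it is known
  that they include the whole free space.
\<close>
definition represents :: "('a::real_normed_vector lip0 \<Rightarrow>\<^sub>L real) \<Rightarrow> 'a \<Rightarrow> bool" where
  "represents m x \<longleftrightarrow> (\<forall>\<phi>. blinfun_apply m (lip0_of_functional \<phi>) = blinfun_apply \<phi> x)"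

lemma represents_add: "\<lbrakk>represents m x; represents n y\<rbrakk> \<Longrightarrow> represents (m + n) (x + y)"
  and represents_diff: "\<lbrakk>represents m x; represents n y\<rbrakk> \<Longrightarrow> represents (m - n) (x - y)"
  and represents_scaleR: "represents m x \<Longrightarrow> represents (c *\<^sub>R m) (c *\<^sub>R x)"
  by (simp_all add: represents_def blinfun.bilinear_simps)

lemma represents_zero: "represents 0 0"
  and represents_delta: "represents (lip_delta x) x"
  by (simp_all add: represents_def blinfun.bilinear_simps lip_delta.rep_eq)

text \<open>
  This is where the Hahn--Banach theorem enters: a functional that norms the barycentre is itself
  a test function of Lipschitz constant at most 1. The bound gives uniqueness of the barycentre,
  the norm of the barycentre map, and the closedness in the next lemma.
\<close>
lemma represents_norm_le:
  assumes "represents m x"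
  shows "norm x \<le> norm m"
proof -
  obtain \<phi> :: "'a \<Rightarrow>\<^sub>L real" where \<phi>: "norm \<phi> \<le> 1" "\<phi> x = norm x"
    by (rule ex_norming_functional)
  have "norm x \<le> norm m * norm (lip0_of_functional \<phi>)"
    using norm_blinfun[of m "lip0_of_functional \<phi>"] assms \<phi>(2) by (simp add: represents_def)
  also have "\<dots> \<le> norm m * 1"
    by (intro mult_left_mono order_trans[OF norm_lip0_of_functional \<phi>(1)]) simp
  finally show ?thesis by simp
qed

lemma represents_unique:
  assumes "represents m x" "represents m y"
  shows "x = y"
  using represents_norm_le[OF represents_diff[OF assms]] by simp

text \<open>
  By the norm bound, barycentres of a convergent sequence of functionals form a Cauchy sequence,
  so completeness supplies a barycentre of the limit.
\<close>
lemma closed_represented: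
  "closed {m. \<exists>x :: 'a::banach. represents m x}"
  unfolding closed_sequential_limits
proof (intro allI impI, elim conjE)
  fix f :: "nat \<Rightarrow> 'a lip0 \<Rightarrow>\<^sub>L real" and l
  assume "\<forall>n. f n \<in> {m. \<exists>x. represents m x}" and l: "f \<longlonglongrightarrow> l"
  then obtain x where x: "\<And>n. represents (f n) (x n)" by simp metis
  have "Cauchy x"
  proof (rule metric_CauchyI)
    fix e :: real assume "0 < e"
    then obtain N where "\<And>m n. m \<ge> N \<Longrightarrow> n \<ge> N \<Longrightarrow> dist (f m) (f n) < e"
      using LIMSEQ_imp_Cauchy[OF l] unfolding Cauchy_def by meson
    then show "\<exists>N. \<forall>m\<ge>N. \<forall>n\<ge>N. dist (x m) (x n) < e"
      unfolding dist_norm using represents_norm_le[OF represents_diff[OF x x]]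
      by (meson le_less_trans)
  qed
  then obtain y where y: "x \<longlonglongrightarrow> y" using Cauchy_convergent_iff convergent_def by blast
  have "represents l y"
    unfolding represents_def
  proof
    fix \<phi> :: "'a \<Rightarrow>\<^sub>L real"
    have "(\<lambda>n. blinfun_apply (f n) (lip0_of_functional \<phi>)) \<longlonglongrightarrow> l (lip0_of_functional \<phi>)"
      by (intro tendsto_intros l)
    moreover have "(\<lambda>n. \<phi> (x n)) \<longlonglongrightarrow> \<phi> y"
      by (intro tendsto_intros y)
    ultimately show "l (lip0_of_functional \<phi>) = \<phi> y"
      using x LIMSEQ_unique by (auto simp: represents_def)
  qed
  then show "l \<in> {m. \<exists>x. represents m x}" by blast
qed

text \<open>
  Every Dirac functional has a barycentre, hence so does every element of the closed span.
\<close>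
theorem ex_barycentre:
  obtains \<beta> :: "'a::banach lipfree \<Rightarrow>\<^sub>L 'a" where "norm \<beta> \<le> 1" "\<And>x. \<beta> (dirac x) = x"
proof -
  have "subspace {m. \<exists>x :: 'a. represents m x}"
    by (rule subspaceI) (auto intro: represents_zero represents_add represents_scaleR)
  then have "closure (span (range (lip_delta :: 'a \<Rightarrow> _))) \<subseteq> {m. \<exists>x. represents m x}"
    by (intro closure_minimal span_minimal closed_represented) (auto intro: represents_delta)
  then have "\<exists>x. represents (lipfree_functional \<mu>) x" for \<mu> :: "'a lipfree"
    using lipfree_functional[of \<mu>] by auto
  then obtain b where b: "\<And>\<mu> :: 'a lipfree. represents (lipfree_functional \<mu>) (b \<mu>)" by metis
  have "bounded_linear b"
  proof (rule bounded_linear_intro)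
    fix \<mu> \<nu> :: "'a lipfree" and c :: real
    show "b (\<mu> + \<nu>) = b \<mu> + b \<nu>"
      using represents_unique[OF b[of "\<mu> + \<nu>"]] represents_add[OF b b] by (simp add: plus_lipfree.rep_eq)
    show "b (c *\<^sub>R \<mu>) = c *\<^sub>R b \<mu>"
      using represents_unique[OF b[of "c *\<^sub>R \<mu>"]] represents_scaleR[OF b] by (simp add: scaleR_lipfree.rep_eq)
    show "norm (b \<mu>) \<le> norm \<mu> * 1"
      using represents_norm_le[OF b[of \<mu>]] by (simp add: norm_lipfree.rep_eq)
  qed
  then have b_apply: "blinfun_apply (Blinfun b) = b" by (rule bounded_linear_Blinfun_apply)
  show thesis
  proof (rule that)
    show "norm (Blinfun b) \<le> 1"
      by (rule norm_blinfun_bound)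
         (use represents_norm_le[OF b] in \<open>simp_all add: b_apply norm_lipfree.rep_eq\<close>)
    show "Blinfun b (dirac x) = x" for x
      using represents_unique[OF b[of "dirac x"]] represents_delta[of x] by (simp add: b_apply dirac.rep_eq)
  qed
qed

section \<open>Linear liftings of a Lipschitz section\<close>

text \<open>
  Halving the step splits the progression into its even and its odd terms, and the odd terms form
  a translate of the even ones by half a step.
\<close>
lemma avg_refine: "avg (2 * n) ((1 / 2) *\<^sub>R v) F y = (1 / 2) *\<^sub>R (avg n v F y + avg n v F (y + (1 / 2) *\<^sub>R v))"
proof -
  have "(\<Sum>k<2 * n. F (y + real k *\<^sub>R ((1 / 2) *\<^sub>R v))) =
      (\<Sum>k<n. F (y + real k *\<^sub>R v)) + (\<Sum>k<n. F (y + (1 / 2) *\<^sub>R v + real k *\<^sub>R v))"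
  proof (induction n)
    case (Suc n)
    have "real (Suc (2 * n)) *\<^sub>R ((1 / 2) *\<^sub>R v) = (1 / 2) *\<^sub>R v + real n *\<^sub>R v"
      by (simp add: add_divide_distrib flip: scaleR_add_left)
    with Suc show ?case by (simp add: add.assoc del: of_nat_Suc)
  qed simp
  then show ?thesis by (simp add: avg_def scaleR_add_right)
qed

text \<open>
  Averages with step \<open>e / 2 ^ m\<close> are Riemann sums for the mean value over the segment from \<open>y\<close>
  to \<open>y + e\<close>. By the preceding lemma, refining the sum moves it by at most half of the Lipschitz bound over
  half a step. Iterated averages are contractions for the uniform norm, so the errors made in the
  different directions simply add up.
\<close>
lemma iter_avg_dyadic_step:
  fixes F :: "'a::real_normed_vector \<Rightarrow> 'v::real_normed_vector"
  assumes lip: "\<And>x y. norm (F x - F (x + y)) \<le> norm y"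
  shows "norm (iter_avg (2 ^ m) (map ((*\<^sub>R) (1 / 2 ^ m)) es) F y -
      iter_avg (2 ^ Suc m) (map ((*\<^sub>R) (1 / 2 ^ Suc m)) es) F y)
    \<le> (\<Sum>e\<leftarrow>es. norm e) * (1 / 2) ^ m"
  using lip
proof (induction es arbitrary: F)
  case (Cons e es)
  let ?v = "(1 / 2 ^ m) *\<^sub>R e"
  define F0 where "F0 = avg (2 ^ m) ?v F"
  define F1 where "F1 = avg (2 ^ Suc m) ((1 / 2 ^ Suc m) *\<^sub>R e) F"
  let ?J0 = "iter_avg (2 ^ m) (map ((*\<^sub>R) (1 / 2 ^ m)) es)"
    and ?J1 = "iter_avg (2 ^ Suc m) (map ((*\<^sub>R) (1 / 2 ^ Suc m)) es)"
  have F0: "norm (F0 x - F0 (x + y)) \<le> norm y" for x y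
    unfolding F0_def by (rule avg_close) (use Cons.prems in auto)
  have "norm (F0 x - F1 (x + 0)) \<le> norm e * (1 / 2) ^ m" for x
  proof -
    have "F1 x = (1 / 2) *\<^sub>R (F0 x + F0 (x + (1 / 2) *\<^sub>R ?v))"
      using avg_refine[of "2 ^ m" ?v F x] by (simp add: F0_def F1_def mult.commute)
    then have "F0 x - F1 x = (1 / 2) *\<^sub>R (F0 x - F0 (x + (1 / 2) *\<^sub>R ?v))"
      by (simp add: algebra_simps flip: scaleR_add_left)
    then have "norm (F0 x - F1 x) \<le> 1 / 2 * norm ((1 / 2) *\<^sub>R ?v)"
      using F0[of x "(1 / 2) *\<^sub>R ?v"] by simp
    also have "\<dots> \<le> norm e * (1 / 2) ^ m" by (simp add: power_divide field_simps)
    finally show ?thesis by simp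
  qed
  then have "norm (?J1 F0 y - ?J1 F1 (y + 0)) \<le> norm e * (1 / 2) ^ m"
    by (rule iter_avg_close[rotated]) simp
  moreover have "norm (?J0 F0 y - ?J1 F0 y) \<le> (\<Sum>e\<leftarrow>es. norm e) * (1 / 2) ^ m"
    by (rule Cons.IH) (rule F0)
  ultimately have "norm (?J0 F0 y - ?J1 F1 y) \<le> (\<Sum>e\<leftarrow>e # es. norm e) * (1 / 2) ^ m"
    using norm_triangle_ineq[of "?J0 F0 y - ?J1 F0 y" "?J1 F0 y - ?J1 F1 y"]
    by (simp add: algebra_simps)
  then show ?case by (simp add: F0_def F1_def)
qed simp

text \<open>
  The limit is the mean value of the function over a parallelepiped; taking it as a norm limit of
  finite averages makes it an element of the Banach space in which the function takes its values.
\<close>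
lemma convergent_iter_avg_dyadic:
  fixes F :: "'a::real_normed_vector \<Rightarrow> 'v::banach"
  assumes lip: "\<And>x y. norm (F x - F (x + y)) \<le> norm y"
  shows "convergent (\<lambda>m. iter_avg (2 ^ m) (map ((*\<^sub>R) (1 / 2 ^ m)) es) F y)" (is "convergent ?J")
proof -
  have "summable (\<lambda>m. ?J m - ?J (Suc m))"
    by (rule summable_comparison_test'[OF summable_mult[OF summable_geometric[of "1 / 2"]]])
       (use iter_avg_dyadic_step[OF lip] in simp_all)
  then have lim: "convergent (\<lambda>n. ?J 0 - ?J n)"
    unfolding summable_iff_convergent sum_lessThan_telescope'[of ?J] .
  have "convergent X" if "convergent (\<lambda>n. a - X n)" for X :: "nat \<Rightarrow> 'v" and a
    using convergent_diff[OF convergent_const[of a] that] by simp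
  from this[of "?J 0" ?J, OF lim] show ?thesis .
qed

lemma remove1_map_scaleR:
  "c \<noteq> 0 \<Longrightarrow> remove1 (c *\<^sub>R v) (map ((*\<^sub>R) c) vs) = map ((*\<^sub>R) c) (remove1 (v :: 'a::real_vector) vs)"
  by (induction vs) auto

text \<open>
  Let \<open>\<Delta> m\<close> be the iterated average of \<open>d\<close> over the grids with steps \<open>e / 2 ^ m\<close>, \<open>e\<close> in \<open>es\<close>, blown
  up by the factor \<open>2 ^ m\<close> around the origin. Averaging along \<open>e\<close> turns the small increment of the
  average in the direction \<open>e / 2 ^ m\<close> into the full increment of \<open>d\<close>, averaged along the remaining
  directions and evaluated near \<open>y / 2 ^ m\<close>. As \<open>m\<close> grows, the increment of \<open>\<Delta> m\<close> by \<open>e\<close> therefore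
  converges in norm to a vector \<open>w e\<close> that does not depend on the base point \<open>y\<close>, and
  \<open>\<beta> (w e) = e\<close> because \<open>\<beta> \<circ> d\<close> is the identity.

  In a general direction there is no convergence. There the increments of \<open>\<Delta> m\<close> are tested against
  a functional \<open>\<phi>\<close>, a generalised limit over \<open>m\<close> gives a Lipschitz function \<open>D \<phi>\<close>, and the invariant
  mean linearises it. The price is that the values lie in the bidual only; in the directions from
  \<open>es\<close> the increments of \<open>D \<phi>\<close> are constant, so there the value is the vector \<open>w e\<close> itself.
\<close>
theorem ex_linear_lifting:
  fixes d :: "'a::real_normed_vector \<Rightarrow> 'v::banach" and \<beta> :: "'v \<Rightarrow>\<^sub>L 'a"
  assumes lip: "\<And>x y. norm (d x - d y) \<le> norm (x - y)" and right_inverse: "\<And>x. \<beta> (d x) = x"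
  obtains U :: "'a \<Rightarrow>\<^sub>L 'v bidual" where "norm U \<le> 1"
    "\<And>e. e \<in> set es \<Longrightarrow> \<exists>w. \<beta> w = e \<and> U e = bidual_embed w"
proof -
  have lip': "norm (d x - d (x + y)) \<le> norm y" for x y
    using lip[of x "x + y"] by simp
  define J where "J m vs = iter_avg (2 ^ m) (map ((*\<^sub>R) (1 / 2 ^ m)) vs) d" for m and vs :: "'a list"
  have J_lip: "norm (J m vs x - J m vs y) \<le> norm (x - y)" for m vs x y
  proof -
    have "norm (J m vs x - J m vs (x + (y - x))) \<le> norm (y - x)"
      unfolding J_def by (rule iter_avg_close) (simp_all add: lip')
    then show ?thesis by (simp add: norm_minus_commute)
  qed
  \<comment> \<open>The average of the identity over translates is the identity up to an additive constant.\<close>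
  have J_section: "\<beta> (J m vs (y + z)) = \<beta> (J m vs y) + z" for m vs y z
  proof -
    have J: "\<beta> (J m vs y) = iter_avg (2 ^ m) (map ((*\<^sub>R) (1 / 2 ^ m)) vs) (\<lambda>y. y) y" for y
      using iter_avg_linear[OF bounded_linear.linear[OF blinfun.bounded_linear_right[of \<beta>]], of _ _ d]
      by (simp add: J_def right_inverse)
    show ?thesis
      unfolding J iter_avg_translate[symmetric] by (simp add: iter_avg_add iter_avg_const)
  qed
  define \<Delta> where "\<Delta> m y = 2 ^ m *\<^sub>R (J m es ((1 / 2 ^ m) *\<^sub>R y) - J m es 0)" for m y
  have \<Delta>0: "\<Delta> m 0 = 0" for m by (simp add: \<Delta>_def)
  have \<Delta>_lip: "norm (\<Delta> m x - \<Delta> m y) \<le> norm (x - y)" for m x y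
  proof -
    have "\<Delta> m x - \<Delta> m y = 2 ^ m *\<^sub>R (J m es ((1 / 2 ^ m) *\<^sub>R x) - J m es ((1 / 2 ^ m) *\<^sub>R y))"
      by (simp add: \<Delta>_def algebra_simps)
    then have "norm (\<Delta> m x - \<Delta> m y)
        \<le> 2 ^ m * norm ((1 / 2 ^ m) *\<^sub>R x - (1 / 2 ^ m) *\<^sub>R y)"
      using J_lip by simp
    then show ?thesis by (simp flip: scaleR_diff_right)
  qed
  have \<Delta>_step: "\<Delta> m (y + e) - \<Delta> m y =
      J m (remove1 e es) ((1 / 2 ^ m) *\<^sub>R y + e) - J m (remove1 e es) ((1 / 2 ^ m) *\<^sub>R y)"
    if "e \<in> set es" for m y e
  proof -
    let ?v = "(1 / 2 ^ m) *\<^sub>R e" and ?y = "(1 / 2 ^ m) *\<^sub>R y"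
    have "J m es (?y + ?v) - J m es ?y = (1 / 2 ^ m) *\<^sub>R (J m (remove1 e es) (?y + e) - J m (remove1 e es) ?y)"
      using iter_avg_telescope[of ?v "map ((*\<^sub>R) (1 / 2 ^ m)) es" "2 ^ m" d ?y] that
      by (simp add: J_def remove1_map_scaleR)
    then show ?thesis by (simp add: \<Delta>_def scaleR_add_right scaleR_diff_right[symmetric])
  qed
  define w where "w e = lim (\<lambda>m. J m (remove1 e es) e - J m (remove1 e es) 0)" for e
  have w: "(\<lambda>m. J m (remove1 e es) e - J m (remove1 e es) 0) \<longlonglongrightarrow> w e" for e
    unfolding w_def J_def
    by (subst convergent_LIMSEQ_iff[symmetric])
       (intro convergent_diff convergent_iter_avg_dyadic lip')
  have \<beta>_w: "\<beta> (w e) = e" for e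
  proof (rule LIMSEQ_unique)
    show "(\<lambda>m. \<beta> (J m (remove1 e es) e - J m (remove1 e es) 0)) \<longlonglongrightarrow> \<beta> (w e)"
      by (intro tendsto_intros w)
    show "(\<lambda>m. \<beta> (J m (remove1 e es) e - J m (remove1 e es) 0)) \<longlonglongrightarrow> e"
      using J_section[of _ _ 0 e] by (simp add: blinfun.diff_right)
  qed
  have \<Delta>_lim: "(\<lambda>m. \<Delta> m (y + e) - \<Delta> m y) \<longlonglongrightarrow> w e" if e: "e \<in> set es" for y e
  proof -
    let ?J = "\<lambda>m. J m (remove1 e es)"
    have "(\<lambda>m. (?J m ((1 / 2 ^ m) *\<^sub>R y + z) - ?J m z)) \<longlonglongrightarrow> 0" for z
    proof (rule Lim_null_comparison)
      show "eventually (\<lambda>m. norm (?J m ((1 / 2 ^ m) *\<^sub>R y + z) - ?J m z) \<le> norm y * (1 / 2) ^ m) sequentially"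
        using J_lip[of _ "remove1 e es" "(1 / 2 ^ _) *\<^sub>R y + z" z]
        by (intro always_eventually) (simp add: power_divide)
      show "(\<lambda>m. norm y * (1 / 2) ^ m) \<longlonglongrightarrow> 0"
        by (intro tendsto_mult_right_zero LIMSEQ_power_zero) simp
    qed
    from tendsto_add[OF w[of e] tendsto_diff[OF this[of e] this[of 0]]]
    show ?thesis by (simp add: \<Delta>_step[OF e])
  qed
  obtain L :: "(nat \<Rightarrow> real) \<Rightarrow> real" where "mean L"
    and limit: "\<And>h l. \<lbrakk>bounded (range h); h \<longlonglongrightarrow> l\<rbrakk> \<Longrightarrow> L h = l"
    by (rule ex_generalised_limit[OF sequentially_bot]) blast
  interpret L: mean L by fact
  obtain M :: "('a \<Rightarrow> real) \<Rightarrow> real" where M: "invariant_mean M"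
    by (rule ex_invariant_mean)
  interpret M: invariant_mean M by fact
  define D where "D \<phi> y = L (\<lambda>m. blinfun_apply \<phi> (\<Delta> m y))" for \<phi> y
  have \<phi>_lip: "\<bar>blinfun_apply \<phi> (\<Delta> m x) - blinfun_apply \<phi> (\<Delta> m y)\<bar> \<le> norm (x - y) * norm \<phi>"
    for \<phi> :: "'v \<Rightarrow>\<^sub>L real" and m x y
  proof -
    have "\<bar>blinfun_apply \<phi> (\<Delta> m x - \<Delta> m y)\<bar> \<le> norm \<phi> * norm (\<Delta> m x - \<Delta> m y)"
      using norm_blinfun[of \<phi> "\<Delta> m x - \<Delta> m y"] by simp
    also have "\<dots> \<le> norm \<phi> * norm (x - y)" by (intro mult_left_mono \<Delta>_lip) simp
    finally show ?thesis by (simp add: blinfun.diff_right mult.commute)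
  qed
  have \<phi>_bdd: "bounded (range (\<lambda>m. blinfun_apply \<phi> (\<Delta> m y)))" for \<phi> :: "'v \<Rightarrow>\<^sub>L real" and y
    using \<phi>_lip[of \<phi> _ y 0] by (auto simp: \<Delta>0 blinfun.zero_right bounded_iff)
  have D_diff: "D \<phi> x - D \<phi> y = L (\<lambda>m. blinfun_apply \<phi> (\<Delta> m x) - blinfun_apply \<phi> (\<Delta> m y))" for \<phi> x y
    unfolding D_def by (rule L.diff[symmetric]) (rule \<phi>_bdd)+
  have D_lip: "\<bar>D \<phi> x - D \<phi> y\<bar> \<le> norm (x - y) * norm \<phi>" for \<phi> x y
    unfolding D_diff by (rule L.bound) (rule \<phi>_lip)
  \<comment> \<open>Linearity in \<open>\<phi>\<close> makes the values of the lifting elements of the bidual.\<close>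
  have D_add: "D (\<phi> + \<psi>) y = D \<phi> y + D \<psi> y" for \<phi> \<psi> y
    using L.add[OF \<phi>_bdd \<phi>_bdd] by (simp add: D_def blinfun.add_left)
  have D_mult: "D (c *\<^sub>R \<phi>) y = c * D \<phi> y" for c \<phi> y
    using L.mult[OF \<phi>_bdd] by (simp add: D_def blinfun.scaleR_left)
  have D_bdd: "bounded (range (\<lambda>y. D \<phi> (y + x) - D \<phi> y))" for \<phi> x
  proof -
    have "\<bar>D \<phi> (y + x) - D \<phi> y\<bar> \<le> norm x * norm \<phi>" for y
      using D_lip[of \<phi> "y + x" y] by simp
    then show ?thesis by (auto simp: bounded_iff)
  qed
  define u where "u x \<phi> = M (\<lambda>y. D \<phi> (y + x) - D \<phi> y)" for x \<phi>
  note u_linear = bounded_linear_mean_increment(1)[OF M D_lip, folded u_def]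
    and u_bound = bounded_linear_mean_increment(2)[OF M D_lip, folded u_def]
  have "bounded_linear (u x)" for x
  proof (rule bounded_linear_intro)
    fix \<phi> \<psi> :: "'v \<Rightarrow>\<^sub>L real" and c :: real
    show "u x (\<phi> + \<psi>) = u x \<phi> + u x \<psi>"
      using M.add[OF D_bdd[of \<phi> x] D_bdd[of \<psi> x]] by (simp add: u_def D_add algebra_simps)
    show "u x (c *\<^sub>R \<phi>) = c *\<^sub>R u x \<phi>"
      using M.mult[OF D_bdd[of \<phi> x], of c] by (simp add: u_def D_mult algebra_simps)
    show "norm (u x \<phi>) \<le> norm \<phi> * norm x"
      using u_bound[of x \<phi>] by (simp add: mult.commute)
  qed
  then have u_apply: "blinfun_apply (Blinfun (u x)) = u x" for x
    by (rule bounded_linear_Blinfun_apply)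
  have norm_u: "norm (Blinfun (u x)) \<le> norm x" for x
    by (rule norm_blinfun_bound) (use u_bound in \<open>simp_all add: u_apply\<close>)
  have "bounded_linear (\<lambda>x. Blinfun (u x))"
  proof (rule bounded_linear_intro)
    fix x y :: 'a and c :: real
    show "Blinfun (u (x + y)) = Blinfun (u x) + Blinfun (u y)"
      by (rule blinfun_eqI)
         (simp add: u_apply blinfun.add_left linear_add[OF bounded_linear.linear[OF u_linear]])
    show "Blinfun (u (c *\<^sub>R x)) = c *\<^sub>R Blinfun (u x)"
      by (rule blinfun_eqI)
         (simp add: u_apply blinfun.scaleR_left linear_scale[OF bounded_linear.linear[OF u_linear]])
    show "norm (Blinfun (u x)) \<le> norm x * 1" using norm_u[of x] by simp
  qed
  then have U_apply: "blinfun_apply (Blinfun (\<lambda>x. Blinfun (u x))) = (\<lambda>x. Blinfun (u x))"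
    by (rule bounded_linear_Blinfun_apply)
  show thesis
  proof (rule that)
    show "norm (Blinfun (\<lambda>x. Blinfun (u x))) \<le> 1"
      by (rule norm_blinfun_bound) (use norm_u in \<open>simp_all add: U_apply\<close>)
    fix e assume e: "e \<in> set es"
    have "u e \<phi> = \<phi> (w e)" for \<phi>
    proof -
      have "D \<phi> (y + e) - D \<phi> y = \<phi> (w e)" for y
        unfolding D_diff
      proof (rule limit)
        show "bounded (range (\<lambda>m. blinfun_apply \<phi> (\<Delta> m (y + e)) - blinfun_apply \<phi> (\<Delta> m y)))"
          by (intro bounded_minus_comp \<phi>_bdd)
        have "(\<lambda>m. \<phi> (\<Delta> m (y + e) - \<Delta> m y)) \<longlonglongrightarrow> \<phi> (w e)"
          by (intro tendsto_intros \<Delta>_lim e)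
        then show "(\<lambda>m. \<phi> (\<Delta> m (y + e)) - \<phi> (\<Delta> m y)) \<longlonglongrightarrow> \<phi> (w e)"
          by (simp add: blinfun.diff_right)
      qed
      then show ?thesis by (simp add: u_def M.const)
    qed
    then have "Blinfun (u e) = bidual_embed (w e)"
      by (intro blinfun_eqI) (simp add: u_apply bidual_embed.rep_eq)
    with \<beta>_w show "\<exists>w. \<beta> w = e \<and> Blinfun (\<lambda>x. Blinfun (u x)) e = bidual_embed w"
      by (auto simp: U_apply)
  qed
qed

section \<open>Transfer of the approximation property\<close>

text \<open>
  Membership in the ideal refers to copies of the spaces inside the universe; the two injections
  provide copies of the outer spaces \<open>'x\<close> and \<open>'y\<close>.
\<close>
lemma (in operator_ideal) ideal_mem_compose:
  fixes U :: "'x::banach \<Rightarrow>\<^sub>L 'a::banach" and S :: "'a \<Rightarrow>\<^sub>L 'b::banach" and R :: "'b \<Rightarrow>\<^sub>L 'y::banach"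
    and i\<^sub>0 :: "'x \<Rightarrow> 'u" and j\<^sub>0 :: "'y \<Rightarrow> 'u"
  assumes S: "ideal_mem A S" and i\<^sub>0: "inj i\<^sub>0" and j\<^sub>0: "inj j\<^sub>0"
  shows "ideal_mem A (R o\<^sub>L (S o\<^sub>L U))"
proof -
  obtain i :: "'a \<Rightarrow> 'u" and j :: "'b \<Rightarrow> 'u" where
    i: "inj i" and j: "inj j" and ST: "transport i j S \<in> A (copy i) (copy j)"
    using S unfolding ideal_mem_def by blast
  have "compose (range i\<^sub>0) (transport j j\<^sub>0 R) (compose (range i\<^sub>0) (transport i j S) (transport i\<^sub>0 i U))
      = transport i\<^sub>0 j\<^sub>0 (R o\<^sub>L (S o\<^sub>L U))"
    using i i\<^sub>0 j by (auto simp: compose_def transport_def fun_eq_iff restrict_def)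
  then have "transport i\<^sub>0 j\<^sub>0 (R o\<^sub>L (S o\<^sub>L U)) \<in> A (copy i\<^sub>0) (copy j\<^sub>0)"
    using ideal[OF banach_space_copy[OF i\<^sub>0] banach_space_copy[OF i] banach_space_copy[OF j]
        banach_space_copy[OF j\<^sub>0] transport_bounded_ops[OF i\<^sub>0 i, of U] ST
        transport_bounded_ops[OF j j\<^sub>0, of R]]
    by simp
  then show ?thesis using i\<^sub>0 j\<^sub>0 by (auto simp: ideal_mem_def)
qed

lemma adjoint_op_adjoint_op_apply [simp]:
  "blinfun_apply (blinfun_apply (adjoint_op (adjoint_op T)) \<phi>) f = blinfun_apply \<phi> (f o\<^sub>L T)"
  by (simp add: adjoint_op.rep_eq)

text \<open>
  The corestriction of the bitranspose inherits its norm and its values on the embedded space,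
  because the canonical embedding is isometric.
\<close>
lemma ex_bidual_extension:
  fixes T :: "'a::banach \<Rightarrow>\<^sub>L 'b::banach"
  assumes "bidual_ideal_mem A T"
  obtains S :: "'a bidual \<Rightarrow>\<^sub>L 'b" where
    "ideal_mem A S" "norm S \<le> norm T" "\<And>x. S (bidual_embed x) = T x"
proof -
  obtain S :: "'a bidual \<Rightarrow>\<^sub>L 'b" where S: "ideal_mem A S"
    "\<And>\<phi>. bidual_embed (S \<phi>) = blinfun_apply (adjoint_op (adjoint_op T)) \<phi>"
    using assms unfolding bidual_ideal_mem_def by blast
  have "norm (S \<phi>) \<le> norm T * norm \<phi>" for \<phi>
  proof -
    have "norm (blinfun_apply (adjoint_op (adjoint_op T)) \<phi>) \<le> norm T * norm \<phi>"
    proof (rule norm_blinfun_bound)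
      fix f :: "'b \<Rightarrow>\<^sub>L real"
      have "norm (blinfun_apply \<phi> (f o\<^sub>L T)) \<le> norm \<phi> * norm (f o\<^sub>L T)" by (rule norm_blinfun)
      also have "\<dots> \<le> norm \<phi> * (norm f * norm T)"
        by (intro mult_left_mono norm_blinfun_compose) simp
      finally show "norm (blinfun_apply (blinfun_apply (adjoint_op (adjoint_op T)) \<phi>) f)
          \<le> norm T * norm \<phi> * norm f"
        by (simp add: mult_ac)
    qed simp
    then show ?thesis using norm_bidual_embed[of "S \<phi>"] S(2) by simp
  qed
  then have "norm S \<le> norm T" by (intro norm_blinfun_bound) auto
  moreover have "S (bidual_embed x) = T x" for x
  proof -
    have "bidual_embed (S (bidual_embed x)) = bidual_embed (T x)"
      unfolding S(2) by (rule blinfun_eqI) (simp add: bidual_embed.rep_eq)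
    then show ?thesis by (rule injD[OF inj_bidual_embed])
  qed
  ultimately show thesis using that S(1) by blast
qed

theorem proposition3p4:
  fixes r :: real
    and A :: "'u vspace \<Rightarrow> 'u vspace \<Rightarrow> ('u \<Rightarrow> 'u) set"
  assumes "r \<ge> 1"
    and universe: "\<exists>\<iota> :: ('a::banach) lipfree bidual \<Rightarrow> 'u. inj \<iota>"
    and "operator_ideal A"
    and "\<And>T :: 'a lipfree \<Rightarrow>\<^sub>L 'a lipfree. ideal_mem A T \<Longrightarrow> bidual_ideal_mem A T"
    and "has_ideal_BAP A r TYPE('a lipfree)"
  shows "has_ideal_BAP A r TYPE('a)"
proof -
  interpret operator_ideal A by fact
  obtain \<beta> :: "'a lipfree \<Rightarrow>\<^sub>L 'a" where norm_\<beta>: "norm \<beta> \<le> 1" and \<beta>: "\<And>x. \<beta> (dirac x) = x"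
    by (rule ex_barycentre) blast
  obtain \<iota> :: "'a lipfree bidual \<Rightarrow> 'u" where \<iota>: "inj \<iota>" using universe by blast
  have "inj (dirac :: 'a \<Rightarrow> 'a lipfree)" by (rule inj_on_inverseI) (rule \<beta>)
  then have inj: "inj (\<iota> \<circ> (bidual_embed \<circ> (dirac :: 'a \<Rightarrow> _)))"
    by (intro inj_compose \<iota> inj_bidual_embed)
  show ?thesis
    unfolding has_ideal_BAP_def closure_of_compact_open_topology
  proof (intro allI impI, elim conjE)
    fix K :: "'a set" and e :: real assume K: "compact K" and e: "0 < e"
    \<comment> \<open>Chosen so that \<open>(r + 1) * \<eta> = e / 2\<close>: the difference between an operator of norm at
      most \<open>r\<close> and the identity varies by at most this much between points at distance \<open>\<eta>\<close>.\<close>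
    define \<eta> where "\<eta> = e / (2 * (r + 1))"
    have \<eta>: "0 < \<eta>" using e \<open>r \<ge> 1\<close> by (simp add: \<eta>_def)
    obtain N where N: "finite N" "K \<subseteq> (\<Union>y\<in>N. ball y \<eta>)"
      using K \<eta> unfolding compact_eq_totally_bounded by blast
    obtain es where es: "set es = N" using finite_list[OF N(1)] by blast
    obtain U :: "'a \<Rightarrow>\<^sub>L 'a lipfree bidual" where norm_U: "norm U \<le> 1"
      and "\<And>y. y \<in> N \<Longrightarrow> \<exists>w. \<beta> w = y \<and> U y = bidual_embed w"
      using ex_linear_lifting[of dirac \<beta> es, OF norm_dirac_diff_le \<beta>] es by metis
    then obtain w where w: "\<And>y. y \<in> N \<Longrightarrow> \<beta> (w y) = y" "\<And>y. y \<in> N \<Longrightarrow> U y = bidual_embed (w y)"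
      by metis
    have "compact (w ` N)" using N(1) by (simp add: finite_imp_compact)
    then obtain T :: "'a lipfree \<Rightarrow>\<^sub>L 'a lipfree" where T: "ideal_mem A T" "norm T \<le> r"
      and near: "\<And>y. y \<in> N \<Longrightarrow> norm (T (w y) - w y) < e / 2"
      using assms(5) e half_gt_zero[OF e]
      unfolding has_ideal_BAP_def closure_of_compact_open_topology by fastforce
    obtain S where S: "ideal_mem A S" "norm S \<le> norm T" "\<And>x. S (bidual_embed x) = T x"
      by (rule ex_bidual_extension[OF assms(4)[OF T(1)]]) blast
    \<comment> \<open>On \<open>N\<close> the lifting takes values in the free space, where \<open>S\<close> is the operator \<open>T\<close>, which is
      close to the identity.\<close>
    define R where "R = \<beta> o\<^sub>L (S o\<^sub>L U)"
    have "norm R \<le> norm \<beta> * (norm S * norm U)"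
      unfolding R_def by (intro order_trans[OF norm_blinfun_compose] mult_left_mono norm_blinfun_compose) simp
    also have "\<dots> \<le> 1 * (r * 1)"
      using S(2) T(2) norm_\<beta> norm_U \<open>r \<ge> 1\<close> by (intro mult_mono) auto
    finally have norm_R: "norm R \<le> r" by simp
    have on_N: "norm (R y - y) < e / 2" if y: "y \<in> N" for y
    proof -
      have "R y - y = \<beta> (T (w y) - w y)"
        using w[OF y] S(3) by (simp add: R_def blinfun.diff_right)
      also have "norm \<dots> \<le> norm \<beta> * norm (T (w y) - w y)" by (rule norm_blinfun)
      also have "\<dots> \<le> 1 * norm (T (w y) - w y)" by (intro mult_right_mono norm_\<beta>) simp
      finally show ?thesis using near[OF y] by simp
    qed
    have "norm (R x - id_blinfun x) < e" if "x \<in> K" for x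
    proof -
      obtain y where y: "y \<in> N" "norm (x - y) < \<eta>"
        using N(2) \<open>x \<in> K\<close> by (auto simp: dist_norm norm_minus_commute)
      have "R x - x = R (x - y) + ((R y - y) - (x - y))"
        by (simp add: blinfun.diff_right)
      also have "norm \<dots> \<le> norm (R (x - y)) + (norm (R y - y) + norm (x - y))"
        by (intro order_trans[OF norm_triangle_ineq] add_left_mono norm_triangle_ineq4)
      also have "norm (R (x - y)) \<le> r * norm (x - y)"
        by (intro order_trans[OF norm_blinfun] mult_right_mono norm_R) simp
      finally have "norm (R x - x) \<le> (r + 1) * norm (x - y) + norm (R y - y)"
        by (simp add: algebra_simps)
      moreover have "(r + 1) * norm (x - y) < e / 2"
        using y(2) \<open>r \<ge> 1\<close> by (simp add: \<eta>_def field_simps)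
      ultimately show ?thesis using on_N[OF y(1)] by simp
    qed
    moreover have "ideal_mem A R" unfolding R_def by (rule ideal_mem_compose[OF S(1) inj inj])
    ultimately show "\<exists>T\<in>{T :: 'a \<Rightarrow>\<^sub>L 'a. ideal_mem A T \<and> norm T \<le> r}.
        \<forall>x\<in>K. norm (T x - id_blinfun x) < e"
      using norm_R by blast
  qed
qed

end
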